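(* Let $f:\mathbb{R}^d\to\mathbb{R}$ be bounded from below by $f^*:=\min_{x\in\mathbb{R}^d}f(x)$ and differentiable with $L$-Lipschitz gradient, i.e. $\|\nabla f(x)-\nabla f(y)\|\le L\|x-y\|$ for all $x,y\in\mathbb{R}^d$. Suppose the stochastic gradients are unbiased and their noise is uniformly bounded by $\sigma_g\ge 0$ (as made precise in the context), let $q>\sigma_g$ with $q>0$, and let the step sizes $\{\alpha_t\}_{t\ge1}$ be positive and nonincreasing with $\alpha_t=\Theta(t^{-(1-\theta)})$ for some $\theta\in(0,1/2)$. Let $\{x_t\}$ be the SGD-CN iterates $x_{t+1}=x_t-\alpha_t g_t^{CN}$. Then, with $\Psi_q(r):=\min\{r^2,qr\}$, $$\sum_{t=1}^{\infty}\alpha_t\Psi_q(\|\nabla f(x_t)\|)<\infty\quad\text{a.s.},$$ and $f(x_t)$ converges almost surely to a finite random variable. Furthermore, $$\min_{1\le i\le t}\Psi_q(\|\nabla f(x_i)\|)=o\Big(\Big(\sum_{i=1}^{t-1}\alpha_i\Big)^{-1}\Big)=o(t^{-\theta})\quad\text{a.s.},$$ and hence $$\min_{1\le i\le t}\|\nabla f(x_i)\|=o(t^{-\theta/2})\quad\text{a.s.}$$ If, in addition, $f$ is $\mu$-strongly convex for some $\mu>0$, i.e. $f(y)\ge f(x)+\langle\nabla f(x),y-x\rangle+\frac{\mu}{2}\|y-x\|^2$ for all $x,y\in\mathbb{R}^d$, then $$\min_{1\le i\le t}\big(f(x_i)-f^*\big)=o(t^{-\theta})\quad\text{a.s.}$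$
   Context: $\|\cdot\|$ is the Euclidean norm on $\mathbb{R}^d$. Stochastic gradient oracle: $\nabla f(x;\xi)$ denotes a (measurable) stochastic gradient at $x$ with random sample $\xi$; at step $t$ a random sample $\xi_t$ is drawn. Clipping: for $q>0$ and $v\in\mathbb{R}^d$, $\mathrm{clip}_q(v):=\min(1,q/\|v\|)\,v$ (with $\mathrm{clip}_q(0)=0$). Clipped noisy stochastic gradient: $g_t^{CN}:=\mathrm{clip}_q(\nabla f(x_t;\xi_t))+q\zeta_t$, where $\zeta_t\sim\mathcal{N}(0,\sigma_{CN}^2 I)$ is zero-mean Gaussian noise in $\mathbb{R}^d$ with variance parameter $\sigma_{CN}^2$, independent of the past and of $\xi_t$. Filtration: $\mathcal{F}_t$ is the natural filtration, i.e. the $\sigma$-algebra generated by the initialization and $\xi_1,\dots,\xi_{t-1},\zeta_1,\dots,\zeta_{t-1}$; the initial point $x_1$ is $\mathcal{F}_1$-measurable, so $x_t$ is $\mathcal{F}_t$-measurable. Unbiasedness: $\mathbb{E}[\nabla f(x_t;\xi_t)\mid\mathcal{F}_t]=\nabla f(x_t)$ for all $t$. Uniformly bounded noise: $\|\nabla f(x;\xi)-\nabla f(x)\|\le\sigma_g$ almost surely for every $x\in\mathbb{R}^d$; in particular $\|\nabla f(x_t;\xi_t)-\nabla f(x_t)\|\le\sigma_g$ a.s. for every $t$. Asymptotic notation $\Theta(\cdot)$, $o(\cdot)$ is as $t\to\infty$; "$o(\cdot)$ a.s." means that the $o(\cdot)$ relation holds along almost every sample path. Step sizes are deterministic. *)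

theory Defs
  imports "HOL-Probability.Probability"
begin

definition clip :: "real \<Rightarrow> 'a::euclidean_space \<Rightarrow> 'a" where
  "clip q v = min 1 (q / norm v) *\<^sub>R v"

definition Psi :: "real \<Rightarrow> real \<Rightarrow> real" where
  "Psi q r = min (r\<^sup>2) (q * r)"

(* The law of s Z for a standard normal vector Z; for s = 0 it is the point mass at 0. *)
definition isotropic_gaussian :: "real \<Rightarrow> 'a::euclidean_space measure" where
  "isotropic_gaussian s =
     distr (density lborel (\<lambda>z::'a. \<Prod>b\<in>Basis. ennreal (std_normal_density (z \<bullet> b))))
           borel (\<lambda>z. s *\<^sub>R z)"

(* real_cond_exp treats positive and negative parts separately, so this is meaningful as soon as
   both parts have a.s. finite conditional expectation, even if X is not integrable. *)
definition vec_cond_exp ::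
    "'w measure \<Rightarrow> 'w measure \<Rightarrow> ('w \<Rightarrow> 'a::euclidean_space) \<Rightarrow> 'w \<Rightarrow> 'a" where
  "vec_cond_exp M F X \<omega> = (\<Sum>b\<in>Basis. real_cond_exp M F (\<lambda>\<omega>'. X \<omega>' \<bullet> b) \<omega> *\<^sub>R b)"

(* Only the space and the sets of the measures below matter: they stand for sigma-algebras. *)
definition sgd_filtration ::
    "'w measure \<Rightarrow> 's measure \<Rightarrow> ('w \<Rightarrow> 'a::euclidean_space) \<Rightarrow>
     (nat \<Rightarrow> 'w \<Rightarrow> 's) \<Rightarrow> (nat \<Rightarrow> 'w \<Rightarrow> 'a) \<Rightarrow> nat \<Rightarrow> 'w measure" where
  "sgd_filtration M S x1 \<xi> \<zeta> t =
     sigma (space M)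
       (sets (vimage_algebra (space M) x1 borel) \<union>
        (\<Union>i\<in>{1..<t}. sets (vimage_algebra (space M) (\<xi> i) S) \<union>
                      sets (vimage_algebra (space M) (\<zeta> i) borel)))"

definition join_rv :: "'w measure \<Rightarrow> 's measure \<Rightarrow> ('w \<Rightarrow> 's) \<Rightarrow> 'w measure" where
  "join_rv F S X = sigma (space F) (sets F \<union> sets (vimage_algebra (space F) X S))"

end

theory Submission
  imports Defs
begin

text \<open>
  Since \<open>\<sigma>\<^sub>g < q\<close>, a sample that is clipped has a positive inner product with the true gradient. Hence
  clipping costs at most a constant factor: for \<open>norm n \<le> \<sigma>\<^sub>g\<close>, the inner product of \<open>v\<close> with
  \<open>clip q (v + n)\<close> is bounded below by \<open>Psi q (norm v) / 4\<close> plus a bounded multiple of \<open>v \<bullet> n\<close> whose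
  factor depends on \<open>v\<close> only. With the descent inequality this makes the gap \<open>f (x t) - fstar\<close> decrease by
  \<open>\<alpha> t * Psi q (norm (gradf (x t))) / 4\<close> per step, up to a martingale difference and a term of order
  \<open>(\<alpha> t)\<^sup>2\<close>. The squared gradient norm is at most \<open>2 L\<close> times the gap, whose weighted
  expectation stays bounded, so the martingale is bounded in \<open>L\<^sup>2\<close> and converges almost surely;
  the rest is a statement about individual paths.
\<close>

section \<open>Smooth functions and clipping\<close>

text \<open>A clipped sample is a biased estimate of the gradient, and unbiasedness removes only
  terms that are linear in the noise. This dictates the form of \<open>inner_clip_ge\<close>: it
  holds for every single noise vector, and outside the term linear in \<open>n\<close> its lower
  bound involves \<open>v\<close> alone. About the law of the samples only the conditional mean at
  the iterate and the bound on the noise are available; since that bound may exceed the gradient,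
  single samples can point against it, and their contribution has to be linearized as well.

  The second obstacle is integrability. Gradients along the iterates are unbounded, and the
  stochastic gradients are not assumed integrable. Second moments of the increments are therefore
  bounded by first moments of the weighted gap, which in turn are bounded by taking expectations in
  the descent inequality. That step needs the increments to be centered, and centering needs the gap
  to be integrable, so integrability and the bound are obtained together, by induction on
  time.\<close>

lemma gderiv_quadratic_upper_bound:
  fixes f :: "'a::euclidean_space \<Rightarrow> real"
  assumes grad: "\<And>v. GDERIV f v :> gradf v" and lip: "L-lipschitz_on UNIV gradf"
  shows "f y \<le> f x + gradf x \<bullet> (y - x) + L / 2 * (norm (y - x))\<^sup>2"
proof -
  define d where "d = y - x"
  \<comment> \<open>The claim is \<open>g 1 \<le> g 0\<close>. The quadratic term is chosen so that
    its derivative dominates the change of the gradient along the segment, which makes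
    \<open>g\<close> nonincreasing.\<close>
  define g where "g s = f (x + s *\<^sub>R d) - s * (gradf x \<bullet> d) - L / 2 * s\<^sup>2 * (norm d)\<^sup>2" for s
  define g' where "g' s = gradf (x + s *\<^sub>R d) \<bullet> d - gradf x \<bullet> d - L * s * (norm d)\<^sup>2" for s
  have "(g has_real_derivative g' s) (at s)" for s
  proof -
    have "(f has_derivative (\<lambda>h. h \<bullet> gradf (x + s *\<^sub>R d))) (at (x + s *\<^sub>R d))"
      using grad[of "x + s *\<^sub>R d"] by (simp add: gderiv_def)
    then have "((\<lambda>s. f (x + s *\<^sub>R d)) has_derivative (\<lambda>h. (h *\<^sub>R d) \<bullet> gradf (x + s *\<^sub>R d))) (at s)"
      by (rule has_derivative_compose[rotated]) (auto intro!: derivative_eq_intros)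
    then have "((\<lambda>s. f (x + s *\<^sub>R d)) has_real_derivative gradf (x + s *\<^sub>R d) \<bullet> d) (at s)"
      by (simp add: has_field_derivative_def inner_commute mult_commute_abs)
    then show ?thesis
      unfolding g_def g'_def by (auto intro!: derivative_eq_intros)
  qed
  moreover have "g' s \<le> 0" if "0 \<le> s" for s
  proof -
    have "norm (gradf (x + s *\<^sub>R d) - gradf x) \<le> L * norm (s *\<^sub>R d)"
      using lipschitz_onD[OF lip, of "x + s *\<^sub>R d" x] by (simp add: dist_norm)
    then have "(gradf (x + s *\<^sub>R d) - gradf x) \<bullet> d \<le> L * norm (s *\<^sub>R d) * norm d"
      by (meson mult_right_mono norm_cauchy_schwarz norm_ge_zero order_trans)
    then show ?thesis
      using that by (simp add: g'_def inner_diff_left power2_eq_square mult.assoc)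
  qed
  ultimately have "g 1 \<le> g 0"
    by (intro DERIV_nonpos_imp_nonincreasing[of 0 1 g] exI[of _ "g' _"] conjI) simp_all
  then show ?thesis
    by (simp add: g_def d_def)
qed

text \<open>A gradient step of size \<open>1 / L\<close> minimizes the quadratic upper bound and
  lowers it by \<open>(norm (gradf x))\<^sup>2 / (2 * L)\<close>; the lower bound \<open>c\<close>
  limits how large this decrease can be.\<close>

lemma norm_gradient_squared_le:
  fixes f :: "'a::euclidean_space \<Rightarrow> real"
  assumes grad: "\<And>v. GDERIV f v :> gradf v" and lip: "L-lipschitz_on UNIV gradf"
    and "0 < L" and low: "\<And>v. c \<le> f v"
  shows "(norm (gradf x))\<^sup>2 \<le> 2 * L * (f x - c)"
proof -
  define y where "y = x - (1 / L) *\<^sub>R gradf x"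
  have "c \<le> f x + gradf x \<bullet> (y - x) + L / 2 * (norm (y - x))\<^sup>2"
    using low gderiv_quadratic_upper_bound[OF grad lip, of y x] by (meson order_trans)
  also have "\<dots> = f x - (norm (gradf x))\<^sup>2 / (2 * L)"
    using \<open>0 < L\<close>
    by (simp add: y_def dot_square_norm power_divide divide_simps) (simp add: power2_eq_square algebra_simps)
  finally show ?thesis
    using \<open>0 < L\<close> by (simp add: field_simps)
qed

text \<open>Completing the square in \<open>w - v\<close> minimizes the strong convexity bound over
  all displacements. With \<open>w\<close> a minimizer of \<open>f\<close> this is the
  Polyak-Lojasiewicz inequality.\<close>

lemma gap_le_norm_gradient_squared:
  fixes f :: "'a::euclidean_space \<Rightarrow> real"
  assumes "0 < \<mu>"
    and "f w \<ge> f v + gradf v \<bullet> (w - v) + \<mu> / 2 * (norm (w - v))\<^sup>2"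
  shows "f v - f w \<le> (norm (gradf v))\<^sup>2 / (2 * \<mu>)"
proof -
  have "0 \<le> (norm (gradf v + \<mu> *\<^sub>R (w - v)))\<^sup>2" by simp
  also have "\<dots> = (norm (gradf v))\<^sup>2 + 2 * \<mu> * (gradf v \<bullet> (w - v)) + \<mu>\<^sup>2 * (norm (w - v))\<^sup>2"
    unfolding power2_norm_eq_inner
    by (simp add: inner_add_left inner_add_right inner_diff_left inner_diff_right inner_commute
        power2_eq_square algebra_simps)
  finally have "0 \<le> (norm (gradf v))\<^sup>2 / (2 * \<mu>) + gradf v \<bullet> (w - v) + \<mu> / 2 * (norm (w - v))\<^sup>2"
    using \<open>0 < \<mu>\<close> by (simp add: field_simps power2_eq_square)
  then show ?thesis using assms(2) by linarith
qed

text \<open>For \<open>\<kappa> = min 1 (q / (r + \<sigma>))\<close>, clipping shrinks samples with positive inner product with the gradient by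
  at most \<open>\<kappa>\<close> and leaves the others alone. The slope is that of the resulting bound after replacing the
  negative part of the inner product by its chord on the range allowed by the noise; for \<open>\<sigma> = 0\<close> the second
  factor is \<open>0 / 0 = 0\<close>, as intended.\<close>

definition clip_slope :: "real \<Rightarrow> real \<Rightarrow> real \<Rightarrow> real" where
  "clip_slope q \<sigma> r = min 1 (q / (r + \<sigma>)) + (1 - min 1 (q / (r + \<sigma>))) * (max 0 (\<sigma> - r) / (2 * \<sigma>))"

lemma clip_slope_bounds:
  assumes "0 \<le> \<sigma>" "0 < q" "0 \<le> r"
  shows "0 \<le> clip_slope q \<sigma> r" "clip_slope q \<sigma> r \<le> 2"
proof -
  define \<kappa> where "\<kappa> = min 1 (q / (r + \<sigma>))"
  define p where "p = max 0 (\<sigma> - r) / (2 * \<sigma>)"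
  have k: "0 \<le> \<kappa>" "\<kappa> \<le> 1" using assms by (auto simp: \<kappa>_def)
  have p: "0 \<le> p" "p \<le> 1" using assms by (auto simp: p_def divide_simps)
  have "(1 - \<kappa>) * p \<le> 1 * 1" using k p by (intro mult_mono) auto
  moreover have "0 \<le> (1 - \<kappa>) * p" using k p by simp
  ultimately show "0 \<le> clip_slope q \<sigma> r" "clip_slope q \<sigma> r \<le> 2"
    unfolding clip_slope_def \<kappa>_def[symmetric] p_def[symmetric] using k by linarith+
qed

lemma norm_clip_le: "0 \<le> q \<Longrightarrow> norm (clip q v) \<le> q"
  by (cases "v = 0") (auto simp: clip_def min_def field_simps)

text \<open>With \<open>m\<close> the component of \<open>n\<close> along \<open>v\<close>, the
  chord contributes a multiple of \<open>m\<close>, which \<open>clip_slope\<close> absorbs, and a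
  constant. Half of \<open>\<kappa> * r\<^sup>2\<close> pays for that constant; the other half is at
  least \<open>Psi q r / 4\<close>.\<close>

lemma inner_clip_ge:
  fixes v n :: "'a::euclidean_space"
  assumes "0 \<le> \<sigma>" "\<sigma> < q" "norm n \<le> \<sigma>"
  shows "Psi q (norm v) / 4 + clip_slope q \<sigma> (norm v) * (v \<bullet> n) \<le> v \<bullet> clip q (v + n)"
proof (cases "v = 0")
  case True
  then show ?thesis by (simp add: Psi_def)
next
  case False
  define r where "r = norm v"
  define \<kappa> where "\<kappa> = min 1 (q / (r + \<sigma>))"
  define p where "p = max 0 (\<sigma> - r)"
  define m where "m = (v \<bullet> n) / r"
  define Y where "Y = v \<bullet> (v + n)"
  have r: "0 < r" and q: "0 < q" using False assms by (auto simp: r_def)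
  have vn: "v \<bullet> n = r * m" using r by (simp add: m_def)
  have "\<bar>v \<bullet> n\<bar> \<le> r * \<sigma>"
    using Cauchy_Schwarz_ineq2[of v n] assms(3) r by (metis mult_left_mono norm_ge_zero order_trans r_def)
  then have m: "- \<sigma> \<le> m" "m \<le> \<sigma>"
    using r by (auto simp: vn abs_le_iff abs_mult) 
  have Y: "Y = r * (r + m)"
    by (simp add: Y_def inner_add_right vn dot_square_norm r_def[symmetric] power2_eq_square algebra_simps)
  have \<kappa>: "0 < \<kappa>" "\<kappa> \<le> 1" using r q assms by (auto simp: \<kappa>_def)
  have clip: "v \<bullet> clip q (v + n) = min 1 (q / norm (v + n)) * Y"
    by (simp add: clip_def Y_def)
  have main: "v \<bullet> clip q (v + n) \<ge> \<kappa> * Y - (1 - \<kappa>) * (r * max 0 (- (r + m)))"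
  proof (cases "0 \<le> r + m")
    case True
    then have "0 \<le> Y" using r Y by simp
    have "norm (v + n) \<le> r + \<sigma>" using norm_triangle_ineq[of v n] assms(3) by (simp add: r_def)
    then have "q / (r + \<sigma>) \<le> q / norm (v + n)" if "v + n \<noteq> 0"
      using q r that assms(1) by (intro divide_left_mono) auto
    \<comment> \<open>At \<open>v + n = 0\<close> the factor is \<open>min 1 (q / 0) = 0\<close>,
      hence the exception; \<open>Y\<close> vanishes there.\<close>
    then have "\<kappa> \<le> min 1 (q / norm (v + n)) \<or> v + n = 0"
      unfolding \<kappa>_def by auto
    then have "\<kappa> * Y \<le> min 1 (q / norm (v + n)) * Y"
      using \<open>0 \<le> Y\<close> by (auto intro: mult_right_mono simp: Y_def)
    then show ?thesis using True by (simp add: clip max_absorb1)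
  next
    \<comment> \<open>A sample pointing against the gradient is shorter than \<open>\<sigma>\<close>, hence is not clipped.\<close>
    case False
    have "(norm (v + n))\<^sup>2 = (norm n)\<^sup>2 + 2 * Y - r\<^sup>2"
      by (simp add: Y_def r_def power2_norm_eq_inner inner_add_left inner_add_right inner_commute algebra_simps)
    moreover have "Y < 0" using False r by (simp add: Y mult_pos_neg)
    ultimately have "(norm (v + n))\<^sup>2 \<le> (norm n)\<^sup>2" by (smt (verit) zero_le_power2)
    then have "norm (v + n) \<le> norm n" by (simp add: power2_le_iff_abs_le)
    then have "norm (v + n) < q" using assms by linarith
    then have "min 1 (q / norm (v + n)) = 1 \<or> v + n = 0"
      by (cases "v + n = 0") (auto simp: min_def field_simps)
    then have "v \<bullet> clip q (v + n) = Y" by (auto simp: clip Y_def)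
    then show ?thesis using False by (simp add: max_def Y algebra_simps)
  qed
  \<comment> \<open>The negative part is convex in \<open>m\<close>, so between
    \<open>- \<sigma>\<close> and \<open>\<sigma>\<close> it lies below the chord through its end
    values \<open>p\<close> and \<open>0\<close>.\<close>
  have neg: "max 0 (- (r + m)) \<le> p * ((\<sigma> - m) / (2 * \<sigma>))"
  proof (cases "r < \<sigma>")
    case True
    have "0 \<le> p * ((\<sigma> - m) / (2 * \<sigma>))" using m assms by (simp add: p_def)
    moreover have "- (r + m) \<le> p * ((\<sigma> - m) / (2 * \<sigma>))"
    proof -
      have "- (r + m) * (2 * \<sigma>) \<le> (\<sigma> - r) * (\<sigma> - m)"
      proof -
        \<comment> \<open>This product is the right side minus the left side of the inequality to be
          shown.\<close>
        have "0 \<le> (r + \<sigma>) * (\<sigma> + m)" using r assms m by simp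
        then show ?thesis by (simp add: algebra_simps)
      qed
      then show ?thesis using True r by (simp add: p_def field_simps)
    qed
    ultimately show ?thesis by simp
  next
    case False
    then show ?thesis using m by (simp add: p_def)
  qed
  have "(1 - \<kappa>) * (r * max 0 (- (r + m))) \<le> (1 - \<kappa>) * (r * (p * ((\<sigma> - m) / (2 * \<sigma>))))"
    using neg r \<kappa> by (intro mult_left_mono) auto
  with main have 1: "v \<bullet> clip q (v + n) \<ge> \<kappa> * Y - (1 - \<kappa>) * (r * (p * ((\<sigma> - m) / (2 * \<sigma>))))"
    by linarith
  \<comment> \<open>For \<open>\<sigma> = 0\<close> the quotient is \<open>0\<close>, and the
    identity survives because \<open>p = 0\<close> as well.\<close>
  have ps: "p * (\<sigma> / (2 * \<sigma>)) = p / 2" using r by (auto simp: p_def)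
  have "p * ((\<sigma> - m) / (2 * \<sigma>)) = p / 2 - p / (2 * \<sigma>) * m"
    unfolding ps[symmetric] by (simp add: diff_divide_distrib right_diff_distrib)
  from 1[unfolded this] have 2: "v \<bullet> clip q (v + n) \<ge> \<kappa> * r\<^sup>2 - (1 - \<kappa>) * (r * (p / 2)) + clip_slope q \<sigma> r * (r * m)"
    unfolding clip_slope_def \<kappa>_def[symmetric] p_def[symmetric] Y
    by (simp add: algebra_simps power2_eq_square del: times_divide_eq_left times_divide_eq_right)
  have 3: "\<kappa> * r\<^sup>2 / 2 \<le> \<kappa> * r\<^sup>2 - (1 - \<kappa>) * (r * (p / 2))"
  proof -
    have "(1 - \<kappa>) * p \<le> \<kappa> * r"
    proof (cases "\<kappa> = 1 \<or> \<sigma> \<le> r")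
      case True
      then show ?thesis using r \<kappa> by (auto simp: p_def)
    next
      case False
      then have k: "\<kappa> = q / (r + \<sigma>)" by (auto simp: \<kappa>_def min_def)
      \<comment> \<open>Both factors use \<open>\<sigma> < q\<close>:
        \<open>r + \<sigma> - q \<le> r\<close> and \<open>\<sigma> - r \<le> q\<close>. Division by
        \<open>r + \<sigma>\<close> gives the inequality for \<open>\<kappa>\<close>.\<close>
      have "(r + \<sigma> - q) * (\<sigma> - r) \<le> r * q"
        using False r assms by (intro mult_mono) auto
      then have "(1 - \<kappa>) * (\<sigma> - r) \<le> \<kappa> * r"
        using r assms unfolding k by (simp add: divide_simps) (simp add: algebra_simps)
      then show ?thesis using False by (simp add: p_def)
    qed
    then have "r / 2 * ((1 - \<kappa>) * p) \<le> r / 2 * (\<kappa> * r)"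
      using r by (intro mult_left_mono) auto
    moreover have "(1 - \<kappa>) * (r * (p / 2)) = r / 2 * ((1 - \<kappa>) * p)" by simp
    moreover have "\<kappa> * r\<^sup>2 / 2 = r / 2 * (\<kappa> * r)" "\<kappa> * r\<^sup>2 = r / 2 * (\<kappa> * r) + r / 2 * (\<kappa> * r)"
      by (simp_all add: power2_eq_square)
    ultimately show ?thesis by linarith
  qed
  \<comment> \<open>\<open>q * r / (r + q)\<close> is at least half the smaller of \<open>q\<close>
    and \<open>r\<close>; multiplying by \<open>r\<close> turns that minimum into
    \<open>Psi\<close>.\<close>
  have 4: "Psi q r / 4 \<le> \<kappa> * r\<^sup>2 / 2"
  proof -
    have "q / (r + q) \<le> q / (r + \<sigma>)" using r q assms by (intro divide_left_mono) auto
    then have k: "q / (r + q) \<le> \<kappa>" using r q by (simp add: \<kappa>_def)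
    have "Psi q r / 2 \<le> q / (r + q) * r\<^sup>2"
    proof (cases "r \<le> q")
      case True
      have "r\<^sup>2 * (r + q) \<le> r\<^sup>2 * (2 * q)" using True by (intro mult_left_mono) auto
      then have "r\<^sup>2 / 2 \<le> q / (r + q) * r\<^sup>2" using r q by (simp add: field_simps)
      then show ?thesis unfolding Psi_def by linarith
    next
      case False
      have "(q * r) * (r + q) \<le> (q * r) * (2 * r)" using False r q by (intro mult_left_mono) auto
      then have "q * r / 2 \<le> q / (r + q) * r\<^sup>2" using r q by (simp add: field_simps power2_eq_square)
      then show ?thesis unfolding Psi_def by linarith
    qed
    also have "\<dots> \<le> \<kappa> * r\<^sup>2" using k by (intro mult_right_mono) auto
    finally show ?thesis by simp
  qed
  show ?thesis using 2 3 4 unfolding vn r_def[symmetric] by linarith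
qed

section \<open>Decreasing sequences perturbed by a convergent series\<close>

text \<open>With all sums on one side, \<open>V n + sum P {..<n} - sum E {..<n}\<close> is
  nonincreasing and bounded below. The errors may change sign, as martingale increments do, since
  the argument rests on the convergence of their partial sums.\<close>

lemma almost_decreasing_convergent:
  fixes V P E :: "nat \<Rightarrow> real"
  assumes "\<And>n. 0 \<le> V n" "\<And>n. 0 \<le> P n" "\<And>n. V (Suc n) \<le> V n - P n + E n" "summable E"
  shows "summable P" "convergent V"
proof -
  have *: "V n + sum P {..<n} - sum E {..<n} \<le> V 0" for n
  proof (induction n)
    case (Suc n)
    then show ?case using assms(3)[of n] by simp
  qed simp
  have "convergent (\<lambda>n. sum E {..<n})" using assms(4) by (simp add: summable_iff_convergent)
  then obtain K where K: "\<And>n. norm (sum E {..<n}) \<le> K"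
    using convergent_imp_Bseq BseqE by metis
  have "sum P {..<n} \<le> V 0 + K" for n
    using *[of n] K[of n] assms(1)[of n] by (auto simp: abs_le_iff)
  then show sP: "summable P"
    using assms(2) by (intro bounded_imp_summable[where B="V 0 + K"]) (auto simp: lessThan_Suc_atMost[symmetric] simp del: sum.lessThan_Suc)
  define U where "U n = V n + sum P {..<n} - sum E {..<n}" for n
  have "decseq U" using assms(3) by (intro decseq_SucI) (smt (verit) U_def sum.lessThan_Suc)
  moreover have "- K \<le> U n" for n
    using assms(1)[of n] K[of n] sum_nonneg[of "{..<n}" P] assms(2) by (auto simp: U_def abs_le_iff)
  ultimately have "convergent U"
    using decseq_convergent convergent_def by metis
  moreover have "V = (\<lambda>n. U n - sum P {..<n} + sum E {..<n})" by (auto simp: U_def)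
  moreover have "convergent (\<lambda>n. sum P {..<n})" using sP by (simp add: summable_iff_convergent)
  ultimately show "convergent V"
    using \<open>convergent (\<lambda>n. sum E {..<n})\<close> by (auto intro!: convergent_add convergent_diff)
qed

section \<open>Square-summable martingale differences\<close>

lemma (in prob_space) martingale_difference_orthogonal:
  fixes Z D :: "'a \<Rightarrow> real"
  assumes "subalgebra M F" "AE \<omega> in M. real_cond_exp M F D \<omega> = 0"
    and "Z \<in> borel_measurable F" "D \<in> borel_measurable M" "integrable M (\<lambda>\<omega>. Z \<omega> * D \<omega>)"
  shows "expectation (\<lambda>\<omega>. Z \<omega> * D \<omega>) = 0"
proof -
  interpret finite_measure_subalgebra M F by unfold_locales (rule assms(1))
  have "expectation (\<lambda>\<omega>. Z \<omega> * D \<omega>) = expectation (\<lambda>\<omega>. Z \<omega> * real_cond_exp M F D \<omega>)"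
    using real_cond_exp_intg(2)[OF assms(5,3,4)] by simp
  also have "\<dots> = 0"
    using assms(2) by (intro integral_eq_zero_AE) auto
  finally show ?thesis .
qed

lemma (in prob_space) integrable_product_of_squares:
  fixes X Y :: "'a \<Rightarrow> real"
  assumes [measurable]: "X \<in> borel_measurable M" "Y \<in> borel_measurable M"
    and "integrable M (\<lambda>\<omega>. (X \<omega>)\<^sup>2)" "integrable M (\<lambda>\<omega>. (Y \<omega>)\<^sup>2)"
  shows "integrable M (\<lambda>\<omega>. X \<omega> * Y \<omega>)"
proof (rule Bochner_Integration.integrable_bound)
  show "integrable M (\<lambda>\<omega>. (X \<omega>)\<^sup>2 + (Y \<omega>)\<^sup>2)" using assms by simp
  have "\<bar>a * b\<bar> \<le> a\<^sup>2 + b\<^sup>2" for a b :: real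
  proof -
    have "2 * (\<bar>a\<bar> * \<bar>b\<bar>) \<le> a\<^sup>2 + b\<^sup>2"
      using sum_squares_bound[of "\<bar>a\<bar>" "\<bar>b\<bar>"] by (simp add: mult.assoc)
    moreover have "0 \<le> \<bar>a\<bar> * \<bar>b\<bar>" by simp
    ultimately show ?thesis unfolding abs_mult by linarith
  qed
  then show "AE \<omega> in M. norm (X \<omega> * Y \<omega>) \<le> norm ((X \<omega>)\<^sup>2 + (Y \<omega>)\<^sup>2)"
    by simp
qed simp

text \<open>Kolmogorov's maximal inequality, by Chebyshev's inequality for the sum stopped when it
  first reaches level \<open>\<epsilon>\<close>.\<close>

lemma (in prob_space) martingale_maximal_inequality:
  fixes D :: "nat \<Rightarrow> 'a \<Rightarrow> real"
  assumes sub: "\<And>n. subalgebra M (F n)" and mono: "\<And>m n. m \<le> n \<Longrightarrow> sets (F m) \<subseteq> sets (F n)"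
    and adapted: "\<And>n. D n \<in> borel_measurable (F (Suc n))"
    and square: "\<And>n. integrable M (\<lambda>\<omega>. (D n \<omega>)\<^sup>2)"
    and md: "\<And>n. AE \<omega> in M. real_cond_exp M (F n) (D n) \<omega> = 0"
    and "0 < \<epsilon>"
  shows "prob {\<omega> \<in> space M. \<exists>j\<le>N. \<epsilon> \<le> \<bar>\<Sum>i<j. D i \<omega>\<bar>} \<le> (\<Sum>i<N. expectation (\<lambda>\<omega>. (D i \<omega>)\<^sup>2)) / \<epsilon>\<^sup>2"
proof -
  have spF: "space (F n) = space M" for n using sub[of n] by (simp add: subalgebra_def)
  have [measurable]: "D i \<in> borel_measurable M" for i
    using measurable_from_subalg[OF sub adapted] .
  have DF: "D i \<in> borel_measurable (F n)" if "i < n" for i n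
    using measurable_from_subalg[of "F n" "F (Suc i)", OF _ adapted] mono[of "Suc i" n] that
    by (simp add: subalgebra_def spF)
  define T where "T j \<omega> = (\<Sum>i<j. D i \<omega>)" for j \<omega>
  have TF: "T j \<in> borel_measurable (F n)" if "j \<le> n" for j n
    unfolding T_def using that by (intro borel_measurable_sum DF) auto
  have [measurable]: "T j \<in> borel_measurable M" for j
    using measurable_from_subalg[OF sub TF] by blast
  \<comment> \<open>\<open>H n\<close> is the indicator that the level has not been reached up to
    time \<open>n\<close>. Since \<open>T n\<close> contains only \<open>D i\<close> with
    \<open>i < n\<close>, it is measurable for \<open>F n\<close>, so \<open>H n * D n\<close> is
    still orthogonal to the past and \<open>X\<close> is the stopped sum.\<close>
  define H where "H n \<omega> = (if \<forall>j\<in>{..n}. \<bar>T j \<omega>\<bar> < \<epsilon> then 1 else 0 :: real)" for n \<omega>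
  have HF: "H n \<in> borel_measurable (F m)" if "n \<le> m" for n m
  proof -
    note TF[of _ m, measurable]
    have "(\<lambda>\<omega>. \<forall>j\<in>{..n}. \<bar>T j \<omega>\<bar> < \<epsilon>) \<in> measurable (F m) (count_space UNIV)"
      using that by (intro pred_intros_finite) auto
    then show ?thesis unfolding H_def by measurable
  qed
  have [measurable]: "H n \<in> borel_measurable M" for n
    using measurable_from_subalg[OF sub HF] by blast
  define X where "X n \<omega> = (\<Sum>i<n. H i \<omega> * D i \<omega>)" for n \<omega>
  have XF: "X n \<in> borel_measurable (F n)" for n
    unfolding X_def by (intro borel_measurable_sum borel_measurable_times HF DF) auto
  have [measurable]: "X n \<in> borel_measurable M" for n
    using measurable_from_subalg[OF sub XF] .
  have H2: "(H n \<omega>)\<^sup>2 = H n \<omega>" "0 \<le> H n \<omega>" "H n \<omega> \<le> 1" for n \<omega> by (auto simp: H_def)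
  have sq: "integrable M (\<lambda>\<omega>. (X n \<omega>)\<^sup>2)
      \<and> expectation (\<lambda>\<omega>. (X n \<omega>)\<^sup>2) \<le> (\<Sum>i<n. expectation (\<lambda>\<omega>. (D i \<omega>)\<^sup>2))" for n
  proof (induction n)
    case 0
    then show ?case by (simp add: X_def)
  next
    case (Suc n)
    have i1: "integrable M (\<lambda>\<omega>. (H n \<omega> * D n \<omega>)\<^sup>2)"
      by (rule Bochner_Integration.integrable_bound[OF square[of n]])
         (auto simp: power_mult_distrib H2 intro!: mult_left_le_one_le)
    have e1: "expectation (\<lambda>\<omega>. (H n \<omega> * D n \<omega>)\<^sup>2) \<le> expectation (\<lambda>\<omega>. (D n \<omega>)\<^sup>2)"
      using i1 square[of n] by (intro integral_mono) (auto simp: power_mult_distrib H2 intro!: mult_left_le_one_le)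
    have i2: "integrable M (\<lambda>\<omega>. X n \<omega> * (H n \<omega> * D n \<omega>))"
      using Suc i1 by (intro integrable_product_of_squares) auto
    have e2: "expectation (\<lambda>\<omega>. X n \<omega> * (H n \<omega> * D n \<omega>)) = 0"
      using martingale_difference_orthogonal[OF sub md, of "\<lambda>\<omega>. X n \<omega> * H n \<omega>" n] i2 XF HF[of n n]
      by (simp add: mult.assoc)
    have "(X (Suc n) \<omega>)\<^sup>2 = (X n \<omega>)\<^sup>2 + (2 * (X n \<omega> * (H n \<omega> * D n \<omega>)) + (H n \<omega> * D n \<omega>)\<^sup>2)" for \<omega>
      by (simp add: X_def power2_eq_square algebra_simps)
    then show ?case using i1 i2 e1 e2 Suc by simp
  qed
  have stop: "\<epsilon> \<le> \<bar>X N \<omega>\<bar>" if "j \<le> N" "\<epsilon> \<le> \<bar>T j \<omega>\<bar>" for j \<omega>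
  proof -
    \<comment> \<open>The first time at the level: every increment from \<open>k\<close> on is
      switched off, so \<open>X N\<close> keeps the value \<open>T k\<close>.\<close>
    define k where "k = (LEAST j. \<epsilon> \<le> \<bar>T j \<omega>\<bar>)"
    have k: "\<epsilon> \<le> \<bar>T k \<omega>\<bar>" unfolding k_def using that(2) by (rule LeastI)
    have "k \<le> N" using Least_le[of "\<lambda>j. \<epsilon> \<le> \<bar>T j \<omega>\<bar>" j] that unfolding k_def by linarith
    have "\<bar>T j \<omega>\<bar> < \<epsilon>" if "j < k" for j
      using not_less_Least[of j "\<lambda>j. \<epsilon> \<le> \<bar>T j \<omega>\<bar>", folded k_def] that by simp
    then have "H n \<omega> = (if n < k then 1 else 0)" for n
      using k unfolding H_def by (cases "n < k") (auto simp: not_less intro!: bexI[of _ k])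
    then have "X N \<omega> = (\<Sum>i<N. if i \<in> {..<k} then D i \<omega> else 0)"
      unfolding X_def by (intro sum.cong) auto
    also have "\<dots> = T k \<omega>" using \<open>k \<le> N\<close> unfolding T_def
      by (subst sum.inter_restrict[symmetric]) (auto intro!: sum.cong)
    finally show ?thesis using k by simp
  qed
  have "prob {\<omega> \<in> space M. \<exists>j\<le>N. \<epsilon> \<le> \<bar>T j \<omega>\<bar>} \<le> prob {\<omega> \<in> space M. \<epsilon>\<^sup>2 \<le> (X N \<omega>)\<^sup>2}"
  proof (rule finite_measure_mono)
    show "{\<omega> \<in> space M. \<epsilon>\<^sup>2 \<le> (X N \<omega>)\<^sup>2} \<in> events" by measurable
    show "{\<omega> \<in> space M. \<exists>j\<le>N. \<epsilon> \<le> \<bar>T j \<omega>\<bar>} \<subseteq> {\<omega> \<in> space M. \<epsilon>\<^sup>2 \<le> (X N \<omega>)\<^sup>2}"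
      using stop \<open>0 < \<epsilon>\<close> by (auto simp: abs_le_square_iff[symmetric])
  qed
  also have "\<dots> \<le> expectation (\<lambda>\<omega>. (X N \<omega>)\<^sup>2) / \<epsilon>\<^sup>2"
    using sq[of N] \<open>0 < \<epsilon>\<close> by (intro integral_Markov_inequality_measure[where A="{}"]) auto
  also have "\<dots> \<le> (\<Sum>i<N. expectation (\<lambda>\<omega>. (D i \<omega>)\<^sup>2)) / \<epsilon>\<^sup>2"
    using sq[of N] by (intro divide_right_mono) auto
  finally show ?thesis by (simp add: T_def)
qed

text \<open>The maximal inequality for the sequence started at \<open>m\<close> bounds the
  probability of any later oscillation by a tail of the variance series. The tails vanish, so almost
  every path has Cauchy partial sums.\<close>

lemma (in prob_space) martingale_difference_series_converges:
  fixes D :: "nat \<Rightarrow> 'a \<Rightarrow> real"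
  assumes sub: "\<And>n. subalgebra M (F n)" and mono: "\<And>m n. m \<le> n \<Longrightarrow> sets (F m) \<subseteq> sets (F n)"
    and adapted: "\<And>n. D n \<in> borel_measurable (F (Suc n))"
    and square: "\<And>n. integrable M (\<lambda>\<omega>. (D n \<omega>)\<^sup>2)"
    and md: "\<And>n. AE \<omega> in M. real_cond_exp M (F n) (D n) \<omega> = 0"
    and summ: "summable (\<lambda>n. expectation (\<lambda>\<omega>. (D n \<omega>)\<^sup>2))"
  shows "AE \<omega> in M. summable (\<lambda>n. D n \<omega>)"
proof -
  have [measurable]: "D i \<in> borel_measurable M" for i
    using measurable_from_subalg[OF sub adapted] .
  define e where "e n = expectation (\<lambda>\<omega>. (D n \<omega>)\<^sup>2)" for n
  have e0: "0 \<le> e n" for n by (simp add: e_def)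
  define Bad where "Bad \<epsilon> m = {\<omega> \<in> space M. \<exists>j. \<epsilon> \<le> \<bar>\<Sum>i<j. D (i + m) \<omega>\<bar>}" for \<epsilon> :: real and m
  have [measurable]: "Bad \<epsilon> m \<in> events" for \<epsilon> m unfolding Bad_def by measurable
  have bad: "prob (Bad \<epsilon> m) \<le> (\<Sum>i. e (i + m)) / \<epsilon>\<^sup>2" if "0 < \<epsilon>" for \<epsilon> m
  proof -
    define A where "A N = {\<omega> \<in> space M. \<exists>j\<le>N. \<epsilon> \<le> \<bar>\<Sum>i<j. D (i + m) \<omega>\<bar>}" for N :: nat
    have "range A \<subseteq> events" unfolding A_def by auto
    moreover have "incseq A" unfolding A_def incseq_def by (auto intro: order_trans)
    ultimately have "(\<lambda>N. prob (A N)) \<longlonglongrightarrow> prob (\<Union>N. A N)"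
      by (rule finite_Lim_measure_incseq)
    moreover have "(\<Union>N. A N) = Bad \<epsilon> m" by (auto simp: A_def Bad_def)
    moreover have "prob (A N) \<le> (\<Sum>i. e (i + m)) / \<epsilon>\<^sup>2" for N
    proof -
      have "prob (A N) \<le> (\<Sum>i<N. e (i + m)) / \<epsilon>\<^sup>2"
        unfolding A_def e_def
        using that martingale_maximal_inequality[of "\<lambda>n. F (n + m)" "\<lambda>n. D (n + m)" \<epsilon> N] sub mono adapted square md
        by simp
      also have "\<dots> \<le> (\<Sum>i. e (i + m)) / \<epsilon>\<^sup>2"
        using summable_ignore_initial_segment[OF summ[folded e_def], of m] e0
        by (intro divide_right_mono sum_le_suminf) auto
      finally show ?thesis .
    qed
    ultimately show ?thesis by (metis LIMSEQ_le_const2)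
  qed
  have null: "AE \<omega> in M. \<exists>m. \<omega> \<notin> Bad (1 / real (Suc k)) m" for k
  proof (rule AE_I)
    let ?\<epsilon> = "1 / real (Suc k)"
    \<comment> \<open>The event that oscillations of this size occur after every starting index; its
      probability is below every tail of the variance series.\<close>
    let ?N = "\<Inter>m. Bad ?\<epsilon> m"
    show "{\<omega> \<in> space M. \<not> (\<exists>m. \<omega> \<notin> Bad ?\<epsilon> m)} \<subseteq> ?N" by auto
    show "?N \<in> events" by auto
    have "(\<lambda>m. (\<Sum>i. e (i + m)) / ?\<epsilon>\<^sup>2) \<longlonglongrightarrow> 0 / ?\<epsilon>\<^sup>2"
      using summ by (intro tendsto_divide suminf_exist_split2) (auto simp: e_def)
    moreover have "prob ?N \<le> (\<Sum>i. e (i + m)) / ?\<epsilon>\<^sup>2" for m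
      by (rule order_trans[OF finite_measure_mono bad[of ?\<epsilon> m]]) auto
    ultimately have "prob ?N \<le> 0"
      by (intro LIMSEQ_le_const[where X="\<lambda>m. (\<Sum>i. e (i + m)) / ?\<epsilon>\<^sup>2"]) auto
    then show "emeasure M ?N = 0"
      by (simp add: emeasure_eq_measure measure_nonneg antisym)
  qed
  then have "AE \<omega> in M. \<forall>k. \<exists>m. \<omega> \<notin> Bad (1 / real (Suc k)) m"
    by (simp add: AE_all_countable)
  then show ?thesis
  proof (rule AE_mp, intro AE_I2 impI)
    fix \<omega> assume \<omega>: "\<omega> \<in> space M" "\<forall>k. \<exists>m. \<omega> \<notin> Bad (1 / real (Suc k)) m"
    show "summable (\<lambda>n. D n \<omega>)"
    proof (rule summable_Cauchy[THEN iffD2], intro allI impI)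
      fix r :: real assume "0 < r"
      then obtain k where k: "1 / real (Suc k) < r / 2"
        using reals_Archimedean[of "r / 2"] by (auto simp: inverse_eq_divide)
      obtain m where m: "\<omega> \<notin> Bad (1 / real (Suc k)) m" using \<omega> by blast
      have small: "\<bar>\<Sum>i<j. D (i + m) \<omega>\<bar> < r / 2" for j
      proof -
        have "\<not> 1 / real (Suc k) \<le> \<bar>\<Sum>i<j. D (i + m) \<omega>\<bar>"
          using m \<omega>(1) unfolding Bad_def by blast
        then show ?thesis using k by linarith
      qed
      \<comment> \<open>A block from \<open>a\<close> to \<open>b\<close> is the difference of two
        blocks that start at \<open>m\<close>, each smaller than \<open>r / 2\<close>.\<close>
      have "norm (sum (\<lambda>n. D n \<omega>) {a..<b}) < r" if "m \<le> a" for a b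
      proof (cases "a \<le> b")
        case True
        have shift: "(\<Sum>i<j. D (i + m) \<omega>) = sum (\<lambda>n. D n \<omega>) {m..<m + j}" for j
          using sum.shift_bounds_nat_ivl[of "\<lambda>n. D n \<omega>" 0 m j] by (simp add: atLeast0LessThan add.commute)
        have "sum (\<lambda>n. D n \<omega>) {a..<b} = sum (\<lambda>n. D n \<omega>) {m..<b} - sum (\<lambda>n. D n \<omega>) {m..<a}"
          using that True sum.atLeastLessThan_concat[of m a b "\<lambda>n. D n \<omega>"] by simp
        then show ?thesis
          using small[of "b - m", unfolded shift] small[of "a - m", unfolded shift] that True by simp
      qed (use \<open>0 < r\<close> in simp)
      then show "\<exists>N. \<forall>a\<ge>N. \<forall>b. norm (sum (\<lambda>n. D n \<omega>) {a..<b}) < r" by blast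
    qed
  qed
qed

section \<open>Rates for running minima\<close>

text \<open>Positivity of \<open>g\<close> lets the constant absorb finitely many early indices.
  Index 0 is excluded because \<open>powr\<close> with base 0 is 0.\<close>

lemma bigo_nat_global_bound:
  fixes f g :: "nat \<Rightarrow> real"
  assumes "f \<in> O(g)" and pos: "\<And>t. 1 \<le> t \<Longrightarrow> 0 < g t"
  shows "\<exists>C>0. \<forall>t\<ge>1. \<bar>f t\<bar> \<le> C * g t"
proof -
  obtain c where c: "0 < c" "\<forall>\<^sub>F t in sequentially. norm (f t) \<le> c * norm (g t)"
    using assms(1) by (elim landau_o.bigE)
  then obtain N where N: "\<And>t. N \<le> t \<Longrightarrow> \<bar>f t\<bar> \<le> c * \<bar>g t\<bar>"
    by (auto simp: eventually_sequentially)
  define K where "K = (\<Sum>i\<in>{1..N}. \<bar>f i\<bar> / g i)"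
  have K: "0 \<le> K" unfolding K_def by (intro sum_nonneg) (auto intro!: divide_nonneg_pos pos)
  have "\<bar>f t\<bar> \<le> (c + K) * g t" if "1 \<le> t" for t
  proof (cases "t \<le> N")
    case True
    have "\<bar>f t\<bar> / g t \<le> K" unfolding K_def
      using that True by (intro member_le_sum) (auto intro!: divide_nonneg_pos pos)
    then have "\<bar>f t\<bar> \<le> K * g t" using pos[OF that] by (simp add: field_simps)
    also have "\<dots> \<le> (c + K) * g t" using c pos[OF that] by (intro mult_right_mono) auto
    finally show ?thesis .
  next
    case False
    then have "\<bar>f t\<bar> \<le> c * g t" using N[of t] pos[OF that] by simp
    also have "\<dots> \<le> (c + K) * g t" using K pos[OF that] by (intro mult_right_mono) auto
    finally show ?thesis .
  qed
  then show ?thesis using c K by (intro exI[of _ "c + K"]) auto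
qed

text \<open>By the mean value theorem each term is at most an increment of
  \<open>real n powr \<theta> / \<theta>\<close>, and the increments telescope.\<close>

lemma sum_powr_le:
  assumes "0 < \<theta>" "\<theta> < 1"
  shows "(\<Sum>i=1..n. real i powr (\<theta> - 1)) \<le> real n powr \<theta> / \<theta>"
proof (induction n)
  case 0
  then show ?case by simp
next
  case (Suc n)
  have "\<theta> * real (Suc n) powr (\<theta> - 1) \<le> real (Suc n) powr \<theta> - real n powr \<theta>"
  \<comment> \<open>The power is not differentiable at 0; for \<open>n = 0\<close> the inequality
    reads \<open>\<theta> \<le> 1\<close>.\<close>
  proof (cases "n = 0")
    case False
    have "\<exists>z>real n. z < real (Suc n) \<and>
        real (Suc n) powr \<theta> - real n powr \<theta> = (real (Suc n) - real n) * (\<theta> * z powr (\<theta> - 1))"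
      using False by (intro MVT2) (auto intro!: derivative_eq_intros)
    then obtain z where z: "real n < z" "z < real (Suc n)"
        "real (Suc n) powr \<theta> - real n powr \<theta> = \<theta> * z powr (\<theta> - 1)" by auto
    have "real (Suc n) powr (\<theta> - 1) \<le> z powr (\<theta> - 1)"
      using z assms False by (intro powr_mono2') auto
    then show ?thesis using z assms by simp
  qed (use assms in simp)
  then have "real (Suc n) powr (\<theta> - 1) \<le> (real (Suc n) powr \<theta> - real n powr \<theta>) / \<theta>"
    using assms by (simp add: field_simps)
  then show ?case using Suc.IH by (simp add: diff_divide_distrib)
qed

text \<open>There are \<open>t - 1 \<ge> t / 2\<close> terms, and the exponent is negative, so each
  is at least \<open>real t powr (\<theta> - 1)\<close>.\<close>

lemma sum_powr_ge:
  assumes "\<theta> < 1" "2 \<le> t"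
  shows "real t powr \<theta> / 2 \<le> (\<Sum>i=1..<t. real i powr (\<theta> - 1))"
proof -
  have "real t powr \<theta> / 2 = real t / 2 * real t powr (\<theta> - 1)"
    using assms by (simp add: powr_diff)
  also have "\<dots> \<le> real (t - 1) * real t powr (\<theta> - 1)"
    using assms by (intro mult_right_mono) auto
  also have "\<dots> = (\<Sum>i=1..<t. real t powr (\<theta> - 1))" by simp
  also have "\<dots> \<le> (\<Sum>i=1..<t. real i powr (\<theta> - 1))"
    using assms by (intro sum_mono powr_mono2') auto
  finally show ?thesis .
qed

text \<open>The two bounds on \<open>\<theta>\<close> have separate roles:
  \<open>\<theta> < 1 / 2\<close> means \<open>2 * (\<theta> - 1) < - 1\<close>, which makes the
  squares summable, and \<open>0 < \<theta>\<close> makes the sum of the steps diverge.\<close>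

lemma step_sum_asymptotics:
  fixes \<alpha> :: "nat \<Rightarrow> real"
  assumes pos: "\<And>t. 1 \<le> t \<Longrightarrow> 0 < \<alpha> t" and \<theta>: "0 < \<theta>" "\<theta> < 1 / 2"
    and Theta: "\<alpha> \<in> \<Theta>(\<lambda>t. real t powr (- (1 - \<theta>)))"
  shows "summable (\<lambda>n. (\<alpha> (Suc n))\<^sup>2)"
    and "filterlim (\<lambda>t. \<Sum>i=1..<t. \<alpha> i) at_top sequentially"
    and "(\<lambda>t. \<Sum>i=1..<t. \<alpha> i) \<in> \<Theta>(\<lambda>t. real t powr \<theta>)"
proof -
  have \<theta>1: "- (1 - \<theta>) = \<theta> - 1" by simp
  have "\<exists>C>0. \<forall>t\<ge>1. \<bar>\<alpha> t\<bar> \<le> C * real t powr (\<theta> - 1)"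
    using Theta unfolding \<theta>1 by (intro bigo_nat_global_bound bigthetaD1) auto
  then obtain C where C: "0 < C" "\<And>t. 1 \<le> t \<Longrightarrow> \<alpha> t \<le> C * real t powr (\<theta> - 1)"
    by (meson abs_ge_self order_trans)
  have "(\<lambda>t. real t powr (\<theta> - 1)) \<in> O(\<alpha>)"
    using Theta unfolding \<theta>1 by (subst (asm) bigtheta_sym) (rule bigthetaD1)
  then have "\<exists>c>0. \<forall>t\<ge>1. \<bar>real t powr (\<theta> - 1)\<bar> \<le> c * \<alpha> t"
    using pos by (rule bigo_nat_global_bound)
  then obtain c where c: "0 < c" "\<And>t. 1 \<le> t \<Longrightarrow> real t powr (\<theta> - 1) \<le> c * \<alpha> t"
    by auto
  show "summable (\<lambda>n. (\<alpha> (Suc n))\<^sup>2)"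
  proof (rule summable_comparison_test')
    have "summable (\<lambda>n. real n powr (2 * (\<theta> - 1)))"
      using \<theta> by (simp add: summable_real_powr_iff)
    then show "summable (\<lambda>n. C\<^sup>2 * real (Suc n) powr (2 * (\<theta> - 1)))"
      by (intro summable_mult) (subst summable_Suc_iff[of "\<lambda>n. real n powr (2 * (\<theta> - 1))"])
    fix n :: nat
    have "(\<alpha> (Suc n))\<^sup>2 \<le> (C * real (Suc n) powr (\<theta> - 1))\<^sup>2"
      using C(2)[of "Suc n"] pos[of "Suc n"] by (intro power_mono) auto
    also have "\<dots> = C\<^sup>2 * real (Suc n) powr (2 * (\<theta> - 1))"
      by (simp add: power_mult_distrib powr_power mult.commute)
    finally show "norm ((\<alpha> (Suc n))\<^sup>2) \<le> C\<^sup>2 * real (Suc n) powr (2 * (\<theta> - 1))"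
      by simp
  qed
  have upper: "(\<Sum>i=1..<t. \<alpha> i) \<le> C / \<theta> * real t powr \<theta>" for t
  proof -
    have "(\<Sum>i=1..<t. \<alpha> i) \<le> (\<Sum>i=1..<t. C * real i powr (\<theta> - 1))"
      using C by (intro sum_mono) auto
    also have "\<dots> \<le> (\<Sum>i=1..t. C * real i powr (\<theta> - 1))"
      using C by (intro sum_mono2) auto
    also have "\<dots> \<le> C * (real t powr \<theta> / \<theta>)"
      unfolding sum_distrib_left[symmetric] using C \<theta> by (intro mult_left_mono sum_powr_le) auto
    finally show ?thesis by simp
  qed
  \<comment> \<open>At \<open>t = 1\<close> the sum is empty while the power is 1, so the bound
    starts at 2.\<close>
  have lower: "1 / (2 * c) * real t powr \<theta> \<le> (\<Sum>i=1..<t. \<alpha> i)" if "2 \<le> t" for t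
  proof -
    have "real t powr \<theta> / 2 \<le> (\<Sum>i=1..<t. c * \<alpha> i)"
      using sum_powr_ge[of \<theta> t] sum_mono[of "{1..<t}" "\<lambda>i. real i powr (\<theta> - 1)" "\<lambda>i. c * \<alpha> i"] c \<theta> that
      by fastforce
    then show ?thesis using c unfolding sum_distrib_left[symmetric] by (simp add: field_simps)
  qed
  have sum0: "0 \<le> (\<Sum>i=1..<t. \<alpha> i)" for t using pos by (intro sum_nonneg) (auto intro: less_imp_le)
  show "(\<lambda>t. \<Sum>i=1..<t. \<alpha> i) \<in> \<Theta>(\<lambda>t. real t powr \<theta>)"
  proof (rule bigthetaI)
    show "(\<lambda>t. \<Sum>i=1..<t. \<alpha> i) \<in> O(\<lambda>t. real t powr \<theta>)"
      using upper sum0 by (intro landau_o.bigI[of "C / \<theta>"]) (use C \<theta> in \<open>auto intro!: always_eventually\<close>)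
    show "(\<lambda>t. \<Sum>i=1..<t. \<alpha> i) \<in> \<Omega>(\<lambda>t. real t powr \<theta>)"
      using c sum0
      by (intro landau_omega.bigI[of "1 / (2 * c)"] eventually_mono[OF eventually_ge_at_top[of "2::nat"]])
         (use lower in \<open>auto simp del: mult_cancel_right2\<close>)
  qed
  have "filterlim (\<lambda>t. real t powr \<theta>) at_top sequentially"
    using \<theta> by (intro filterlim_compose[OF real_powr_at_top filterlim_real_sequentially]) auto
  then have "filterlim (\<lambda>t. 1 / (2 * c) * real t powr \<theta>) at_top sequentially"
    using c by (intro filterlim_tendsto_pos_mult_at_top[OF tendsto_const]) auto
  then show "filterlim (\<lambda>t. \<Sum>i=1..<t. \<alpha> i) at_top sequentially"
    by (rule filterlim_at_top_mono) (use lower in \<open>auto simp: eventually_sequentially\<close>)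
qed

text \<open>Comparing the minimum with the tail of the weighted series from a fixed index \<open>s\<close> on, and
  absorbing the first \<open>s\<close> weights into the rest.\<close>

lemma running_min_smallo:
  fixes \<alpha> p :: "nat \<Rightarrow> real"
  assumes pos: "\<And>t. 1 \<le> t \<Longrightarrow> 0 < \<alpha> t" and p: "\<And>t. 0 \<le> p t"
    and summ: "summable (\<lambda>n. \<alpha> (Suc n) * p (Suc n))"
    and div: "filterlim (\<lambda>t. \<Sum>i=1..<t. \<alpha> i) at_top sequentially"
  shows "(\<lambda>t. MIN i\<in>{1..t}. p i) \<in> o(\<lambda>t. inverse (\<Sum>i=1..<t. \<alpha> i))"
proof (rule landau_o.smallI)
  fix c :: real assume "0 < c"
  define A where "A t = (\<Sum>i=1..<t. \<alpha> i)" for t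
  obtain N where N: "\<And>m n. N \<le> m \<Longrightarrow> \<bar>\<Sum>i=m..<n. \<alpha> (Suc i) * p (Suc i)\<bar> < c / 2"
    using summable_Cauchy[THEN iffD1, OF summ, rule_format, of "c / 2"] \<open>0 < c\<close> by auto
  define s where "s = Suc N"
  \<comment> \<open>From \<open>2 * A s \<le> A t\<close> follows
    \<open>A t \<le> 2 * (A t - A s)\<close>, which uses up the factor in \<open>c / 2\<close>; the
    added 1 makes \<open>A t\<close> positive and hence invertible.\<close>
  have "\<forall>\<^sub>F t in sequentially. 2 * A s + 1 \<le> A t"
    using div[folded A_def] unfolding filterlim_at_top by blast
  then show "\<forall>\<^sub>F t in sequentially. norm (MIN i\<in>{1..t}. p i) \<le> c * norm (inverse (\<Sum>i=1..<t. \<alpha> i))"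
    using eventually_gt_at_top[of s]
  proof eventually_elim
    case (elim t)
    define m where "m = (MIN i\<in>{1..t}. p i)"
    have m: "m \<le> p i" if "1 \<le> i" "i \<le> t" for i
      unfolding m_def using that by (intro Min_le) auto
    have "1 \<le> t" using elim by (simp add: s_def)
    then have "m \<in> p ` {1..t}" unfolding m_def by (intro Min_in) auto
    then have m0: "0 \<le> m" using p by auto
    have A0: "0 \<le> A s" unfolding A_def using pos by (intro sum_nonneg) (auto intro: less_imp_le)
    have "A t = A s + (\<Sum>i=s..<t. \<alpha> i)"
      unfolding A_def using elim by (intro sum.atLeastLessThan_concat[symmetric]) (auto simp: s_def)
    then have "m * (A t - A s) = (\<Sum>i=s..<t. \<alpha> i * m)"
      by (simp add: sum_distrib_left mult.commute)
    also have "\<dots> \<le> (\<Sum>i=s..<t. \<alpha> i * p i)"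
      using m pos by (intro sum_mono mult_left_mono) (auto simp: s_def intro: less_imp_le)
    also have "\<dots> \<le> c / 2"
    proof -
      obtain n where n: "t = Suc n" using elim by (cases t) auto
      show ?thesis using N[of N n] unfolding n s_def sum.shift_bounds_Suc_ivl by simp
    qed
    finally have "2 * (m * (A t - A s)) \<le> c" by simp
    moreover have "m * A t \<le> m * (2 * (A t - A s))" using m0 elim by (intro mult_left_mono) auto
    ultimately have "m * A t \<le> c" by (simp add: algebra_simps)
    moreover have "0 < A t" using A0 elim by linarith
    ultimately show ?case using m0 unfolding A_def m_def by (simp add: field_simps)
  qed
qed

lemma Psi_nonneg: "0 \<le> q \<Longrightarrow> 0 \<le> r \<Longrightarrow> 0 \<le> Psi q r"
  by (simp add: Psi_def)

text \<open>Once the minimum of \<open>Psi\<close> is below \<open>q\<^sup>2\<close>, the index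
  attaining it has \<open>r i \<le> q\<close>, where \<open>Psi\<close> is the square. This
  transfers the rate to anything dominated by the squared norm.\<close>

lemma running_min_quadratic_smallo:
  fixes r h :: "nat \<Rightarrow> real"
  assumes "0 < q" "0 < \<theta>" and r: "\<And>i. 0 \<le> r i" and h: "\<And>i. 0 \<le> h i" "\<And>i. h i \<le> K * (r i)\<^sup>2"
    and K: "0 \<le> K"
    and small: "(\<lambda>t. MIN i\<in>{1..t}. Psi q (r i)) \<in> o(\<lambda>t. real t powr (- \<theta>))"
  shows "(\<lambda>t. MIN i\<in>{1..t}. h i) \<in> o(\<lambda>t. real t powr (- \<theta>))"
proof (rule landau_o.big_small_trans[OF _ small], rule landau_o.bigI)
  \<comment> \<open>\<open>K\<close> may be 0, but the constant of a big-O bound must be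
    positive.\<close>
  show "0 < K + 1" using K by simp
  \<comment> \<open>The power is at most 1 for \<open>t \<ge> 1\<close>, so the constant
    \<open>q\<^sup>2 / 2\<close> puts the minimum strictly below \<open>q\<^sup>2\<close>.\<close>
  have "\<forall>\<^sub>F t in sequentially. norm (MIN i\<in>{1..t}. Psi q (r i)) \<le> q\<^sup>2 / 2 * norm (real t powr (- \<theta>))"
    using \<open>0 < q\<close> by (intro landau_o.smallD[OF small]) simp
  then show "\<forall>\<^sub>F t in sequentially. norm (MIN i\<in>{1..t}. h i) \<le> (K + 1) * norm (MIN i\<in>{1..t}. Psi q (r i))"
    using eventually_ge_at_top[of 1]
  proof eventually_elim
    case (elim t)
    define m where "m = (MIN i\<in>{1..t}. Psi q (r i))"
    have "m \<in> (\<lambda>i. Psi q (r i)) ` {1..t}" unfolding m_def using elim by (intro Min_in) auto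
    then obtain i where i: "i \<in> {1..t}" "m = Psi q (r i)" by auto
    have m0: "0 \<le> m" using i r \<open>0 < q\<close> by (simp add: Psi_nonneg)
    have "real t powr (- \<theta>) \<le> real t powr 0" using elim \<open>0 < \<theta>\<close> by (intro powr_mono) auto
    then have "q\<^sup>2 / 2 * norm (real t powr (- \<theta>)) \<le> q\<^sup>2 / 2 * 1" using elim by (intro mult_left_mono) auto
    moreover have "norm m = m" using m0 by simp
    ultimately have "m \<le> q\<^sup>2 / 2" using elim(1)[folded m_def] by linarith
    moreover have "0 < q\<^sup>2" using \<open>0 < q\<close> by simp
    ultimately have "m < q\<^sup>2" by linarith
    have "r i \<le> q"
    proof (rule ccontr)
      assume "\<not> r i \<le> q"
      then have "q\<^sup>2 \<le> (r i)\<^sup>2" "q\<^sup>2 \<le> q * r i" using \<open>0 < q\<close> by (auto simp: power2_eq_square intro: mult_mono)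
      then show False using \<open>m < q\<^sup>2\<close> i by (simp add: Psi_def)
    qed
    then have "m = (r i)\<^sup>2" using r[of i] i by (simp add: Psi_def power2_eq_square mult_right_mono)
    have "(MIN i\<in>{1..t}. h i) \<in> h ` {1..t}" using elim by (intro Min_in) auto
    then have "0 \<le> (MIN i\<in>{1..t}. h i)" using h by auto
    moreover have "(MIN i\<in>{1..t}. h i) \<le> h i" using i by (intro Min_le) auto
    moreover have "h i \<le> (K + 1) * m" using h(2)[of i, folded \<open>m = (r i)\<^sup>2\<close>] m0 by (simp add: algebra_simps)
    ultimately show ?case using m0 unfolding m_def[symmetric] by simp
  qed
qed

lemma running_min_smallo_sqrt:
  fixes r :: "nat \<Rightarrow> real"
  assumes r: "\<And>i. 0 \<le> r i" and small: "(\<lambda>t. MIN i\<in>{1..t}. (r i)\<^sup>2) \<in> o(\<lambda>t. real t powr (- \<theta>))"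
  shows "(\<lambda>t. MIN i\<in>{1..t}. r i) \<in> o(\<lambda>t. real t powr (- \<theta> / 2))"
proof (rule landau_o.smallI)
  fix c :: real assume "0 < c"
  then have "\<forall>\<^sub>F t in sequentially. norm (MIN i\<in>{1..t}. (r i)\<^sup>2) \<le> c\<^sup>2 * norm (real t powr (- \<theta>))"
    by (intro landau_o.smallD[OF small]) simp
  then show "\<forall>\<^sub>F t in sequentially. norm (MIN i\<in>{1..t}. r i) \<le> c * norm (real t powr (- \<theta> / 2))"
    using eventually_ge_at_top[of 1]
  proof eventually_elim
    case (elim t)
    have "(MIN i\<in>{1..t}. r i) \<in> r ` {1..t}" using elim by (intro Min_in) auto
    then have m0: "0 \<le> (MIN i\<in>{1..t}. r i)" using r by auto
    have "(MIN i\<in>{1..t}. (r i)\<^sup>2) \<in> (\<lambda>i. (r i)\<^sup>2) ` {1..t}" using elim by (intro Min_in) auto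
    then obtain i where i: "i \<in> {1..t}" "(MIN i\<in>{1..t}. (r i)\<^sup>2) = (r i)\<^sup>2" by auto
    have "(MIN i\<in>{1..t}. r i) \<le> r i" using i by (intro Min_le) auto
    moreover have "r i \<le> c * real t powr (- \<theta> / 2)"
    proof (rule power2_le_imp_le)
      have "(real t powr (- \<theta> / 2))\<^sup>2 = real t powr (- \<theta>)"
        by (simp add: power2_eq_square flip: powr_add)
      then show "(r i)\<^sup>2 \<le> (c * real t powr (- \<theta> / 2))\<^sup>2" using elim i by (simp add: power_mult_distrib)
    qed (use \<open>0 < c\<close> in simp)
    ultimately show ?case using m0 by simp
  qed
qed

section \<open>Isotropic Gaussian noise\<close>

abbreviation std_gaussian :: "'a::euclidean_space measure" where
  "std_gaussian \<equiv> density lborel (\<lambda>z. \<Prod>b\<in>Basis. ennreal (std_normal_density (z \<bullet> b)))"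

text \<open>With the square moved into the factor of coordinate \<open>b\<close>, the integrand is a
  product over coordinates. One factor integrates to the second moment, the others to the total
  mass, and all of these are 1.\<close>

lemma std_gaussian_integrable_square:
  assumes "b \<in> Basis"
  shows "integrable (std_gaussian :: 'a::euclidean_space measure) (\<lambda>z. (z \<bullet> b)\<^sup>2)"
proof (rule integrableI_bounded)
  have n0: "(\<integral>\<^sup>+x. ennreal (std_normal_density x) \<partial>lborel) = 1"
    using std_normal_moment_even[of 0] by (subst nn_integral_eq_integral) (auto simp: has_bochner_integral_iff)
  have n2: "(\<integral>\<^sup>+x. ennreal (std_normal_density x * x\<^sup>2) \<partial>lborel) = 1"
    using std_normal_moment_even[of 1] by (subst nn_integral_eq_integral) (auto simp: has_bochner_integral_iff)
  let ?f = "\<lambda>b' x. if b' = b then ennreal (std_normal_density x * x\<^sup>2) else ennreal (std_normal_density x)"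
  have "(\<integral>\<^sup>+z. ennreal (norm ((z \<bullet> b)\<^sup>2)) \<partial>(std_gaussian :: 'a measure))
      = (\<integral>\<^sup>+z. (\<Prod>b\<in>Basis. ennreal (std_normal_density (z \<bullet> b))) * ennreal ((z \<bullet> b)\<^sup>2) \<partial>lborel)"
    by (subst nn_integral_density) auto
  also have "\<dots> = (\<integral>\<^sup>+z. (\<Prod>b'\<in>Basis. ?f b' (z \<bullet> b')) \<partial>lborel)"
  proof (rule nn_integral_cong)
    fix z :: 'a
    have "(\<Prod>b'\<in>Basis. ?f b' (z \<bullet> b'))
        = (\<Prod>b'\<in>Basis. ennreal (std_normal_density (z \<bullet> b')) * (if b' = b then ennreal ((z \<bullet> b)\<^sup>2) else 1))"
      by (intro prod.cong) (auto simp: ennreal_mult)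
    then show "(\<Prod>b\<in>Basis. ennreal (std_normal_density (z \<bullet> b))) * ennreal ((z \<bullet> b)\<^sup>2)
        = (\<Prod>b'\<in>Basis. ?f b' (z \<bullet> b'))"
      using assms by (simp add: prod.distrib prod.delta)
  qed
  also have "\<dots> = (\<Prod>b'\<in>Basis. (\<integral>\<^sup>+x. ?f b' x \<partial>lborel))"
    by (intro nn_integral_lborel_prod) auto
  also have "\<dots> = 1"
  proof (intro prod.neutral ballI)
    show "(\<integral>\<^sup>+x. ?f b' x \<partial>lborel) = 1" for b'
      by (cases "b' = b") (simp_all add: n0 n2)
  qed
  finally show "(\<integral>\<^sup>+z. ennreal (norm ((z \<bullet> b)\<^sup>2)) \<partial>(std_gaussian :: 'a measure)) < \<infinity>" by simp
qed simp

text \<open>The density is even and \<open>lborel\<close> is invariant under reflection, so the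
  integral equals its own negative.\<close>

lemma std_gaussian_mean_zero:
  "(\<integral>z. z \<bullet> b \<partial>(std_gaussian :: 'a::euclidean_space measure)) = 0"
proof -
  define h where "h z = (\<Prod>c\<in>Basis. std_normal_density (z \<bullet> c)) *\<^sub>R (z \<bullet> b)" for z :: 'a
  have [measurable]: "h \<in> borel_measurable borel" unfolding h_def by measurable
  have "(\<integral>z. z \<bullet> b \<partial>(std_gaussian :: 'a measure)) = (\<integral>z. h z \<partial>lborel)"
    unfolding h_def prod_ennreal[OF normal_density_nonneg]
    by (subst integral_density) (auto intro!: prod_nonneg)
  moreover have "lborel = distr lborel borel (\<lambda>z::'a. - z)"
    using lborel_affine[of "-1" "0::'a"] by (simp add: density_1)
  then have "(\<integral>z. h z \<partial>lborel) = (\<integral>z. h z \<partial>distr lborel borel (\<lambda>z::'a. - z))" by simp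
  then have "(\<integral>z. h z \<partial>lborel) = (\<integral>z. h (- z) \<partial>lborel)" by (simp add: integral_distr)
  moreover have "h (- z) = - h z" for z by (simp add: h_def std_normal_density_def)
  then have "(\<integral>z. h (- z) \<partial>lborel) = - (\<integral>z. h z \<partial>lborel)" by simp
  ultimately show ?thesis by linarith
qed

lemma isotropic_gaussian_integrable_norm_square:
  "integrable (isotropic_gaussian s :: 'a::euclidean_space measure) (\<lambda>z. (norm z)\<^sup>2)"
proof -
  have "integrable (std_gaussian :: 'a measure) (\<lambda>z. s\<^sup>2 * (\<Sum>b\<in>Basis. (z \<bullet> b)\<^sup>2))"
    by (intro integrable_mult_right Bochner_Integration.integrable_sum std_gaussian_integrable_square)
  moreover have "(\<Sum>b\<in>Basis. (z \<bullet> b)\<^sup>2) = (norm z)\<^sup>2" for z :: 'a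
    by (subst power2_norm_eq_inner, subst euclidean_inner) (simp add: power2_eq_square)
  ultimately show ?thesis
    unfolding isotropic_gaussian_def by (subst integrable_distr_eq) (auto simp: power_mult_distrib)
qed

lemma isotropic_gaussian_mean_zero:
  "(\<integral>z. z \<bullet> b \<partial>(isotropic_gaussian s :: 'a::euclidean_space measure)) = 0"
  unfolding isotropic_gaussian_def by (subst integral_distr) (auto simp: std_gaussian_mean_zero)

section \<open>The natural filtration\<close>

lemma space_sgd_filtration [simp]: "space (sgd_filtration M S x1 \<xi> \<zeta> t) = space M"
  by (simp add: sgd_filtration_def space_measure_of_conv)

lemma sets_sgd_filtration:
  "sets (sgd_filtration M S x1 \<xi> \<zeta> t) = sigma_sets (space M)
     (sets (vimage_algebra (space M) x1 borel) \<union>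
        (\<Union>i\<in>{1..<t}. sets (vimage_algebra (space M) (\<xi> i) S) \<union>
                      sets (vimage_algebra (space M) (\<zeta> i) borel)))"
proof -
  have "sets (vimage_algebra (space M) f N) \<subseteq> Pow (space M)" for f :: "'a \<Rightarrow> 'c" and N
    using sets.sets_into_space[of _ "vimage_algebra (space M) f N"] by auto
  moreover have "sets (vimage_algebra (space M) f N) \<subseteq> Pow (space M)" for f :: "'a \<Rightarrow> 'b" and N
    using sets.sets_into_space[of _ "vimage_algebra (space M) f N"] by auto
  ultimately show ?thesis unfolding sgd_filtration_def by (intro sets_measure_of) blast
qed

lemma sets_sgd_filtration_mono:
  "s \<le> t \<Longrightarrow> sets (sgd_filtration M S x1 \<xi> \<zeta> s) \<subseteq> sets (sgd_filtration M S x1 \<xi> \<zeta> t)"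
  unfolding sets_sgd_filtration by (intro sigma_sets_mono') (auto; fastforce)

lemma sets_vimage_algebra_subset:
  "f \<in> measurable M N \<Longrightarrow> sets (vimage_algebra (space M) f N) \<subseteq> sets M"
  unfolding sets_vimage_algebra by (intro sets.sigma_sets_subset) (auto intro: measurable_sets)

lemma subalgebra_sgd_filtration:
  assumes "x1 \<in> borel_measurable M" "\<And>t. 1 \<le> t \<Longrightarrow> \<xi> t \<in> measurable M S"
    and "\<And>t. 1 \<le> t \<Longrightarrow> \<zeta> t \<in> borel_measurable M"
  shows "subalgebra M (sgd_filtration M S x1 \<xi> \<zeta> t)"
  unfolding subalgebra_def sets_sgd_filtration
proof (intro conjI sets.sigma_sets_subset Un_least UN_least)
  show "sets (vimage_algebra (space M) x1 borel) \<subseteq> sets M"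
    by (intro sets_vimage_algebra_subset assms)
  fix i assume "i \<in> {1..<t}"
  then show "sets (vimage_algebra (space M) (\<xi> i) S) \<subseteq> sets M"
    "sets (vimage_algebra (space M) (\<zeta> i) borel) \<subseteq> sets M"
    by (auto intro!: sets_vimage_algebra_subset assms simp del: sets_vimage_algebra)
qed simp

lemma measurableI_vimage_algebra:
  assumes "f \<in> measurable M N" "space F = space M" "sets (vimage_algebra (space M) f N) \<subseteq> sets F"
  shows "f \<in> measurable F N"
proof (rule measurableI)
  fix x assume "x \<in> space F" then show "f x \<in> space N"
    using assms(1,2) by (auto dest: measurable_space)
next
  fix A assume "A \<in> sets N" then show "f -` A \<inter> space F \<in> sets F"
    using in_vimage_algebra[of A N f "space M"] assms(2,3) by auto
qed

lemma sgd_filtration_measurable: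
  assumes "x1 \<in> borel_measurable M" "\<And>t. 1 \<le> t \<Longrightarrow> \<xi> t \<in> measurable M S"
    and "\<And>t. 1 \<le> t \<Longrightarrow> \<zeta> t \<in> borel_measurable M"
  shows "x1 \<in> borel_measurable (sgd_filtration M S x1 \<xi> \<zeta> t)"
    and "\<And>i. 1 \<le> i \<Longrightarrow> i < t \<Longrightarrow> \<xi> i \<in> measurable (sgd_filtration M S x1 \<xi> \<zeta> t) S"
    and "\<And>i. 1 \<le> i \<Longrightarrow> i < t \<Longrightarrow> \<zeta> i \<in> borel_measurable (sgd_filtration M S x1 \<xi> \<zeta> t)"
proof -
  have *: "sets (vimage_algebra (space M) x1 borel) \<union>
        (\<Union>i\<in>{1..<t}. sets (vimage_algebra (space M) (\<xi> i) S) \<union>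
                      sets (vimage_algebra (space M) (\<zeta> i) borel))
      \<subseteq> sets (sgd_filtration M S x1 \<xi> \<zeta> t)"
    unfolding sets_sgd_filtration by (rule sigma_sets_superset_generator)
  show "x1 \<in> borel_measurable (sgd_filtration M S x1 \<xi> \<zeta> t)"
    using * by (intro measurableI_vimage_algebra[OF assms(1)]) auto
  fix i :: nat assume i: "1 \<le> i" "i < t"
  then have "i \<in> {1..<t}" by simp
  with * have sub: "sets (vimage_algebra (space M) (\<xi> i) S) \<subseteq> sets (sgd_filtration M S x1 \<xi> \<zeta> t)"
      "sets (vimage_algebra (space M) (\<zeta> i) borel) \<subseteq> sets (sgd_filtration M S x1 \<xi> \<zeta> t)"
    by blast+
  show "\<xi> i \<in> measurable (sgd_filtration M S x1 \<xi> \<zeta> t) S"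
    using sub by (intro measurableI_vimage_algebra[OF assms(2)[OF i(1)]]) simp_all
  show "\<zeta> i \<in> borel_measurable (sgd_filtration M S x1 \<xi> \<zeta> t)"
    using sub by (intro measurableI_vimage_algebra[OF assms(3)[OF i(1)]]) simp_all
qed

lemma sets_join_rv:
  "sets (join_rv F S X) = sigma_sets (space F) (sets F \<union> sets (vimage_algebra (space F) X S))"
proof -
  have "sets (vimage_algebra (space F) X S) \<subseteq> Pow (space F)"
    using sets.sets_into_space[of _ "vimage_algebra (space F) X S"] by auto
  then show ?thesis
    unfolding join_rv_def using sets.space_closed[of F] by (intro sets_measure_of) auto
qed

lemma subalgebra_join_rv: "subalgebra (join_rv F S X) F"
  unfolding subalgebra_def sets_join_rv by (auto simp: join_rv_def space_measure_of_conv)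

text \<open>Turns independence of sigma-algebras, the form of the hypothesis on the Gaussian noise,
  into the product rule for expectations of functions measurable for them.\<close>

lemma (in prob_space) indep_var_of_indep_sigma:
  assumes "indep_set (sets H) (sets H')" "space H = space M" "space H' = space M"
    and X: "X \<in> measurable H N" and Y: "Y \<in> measurable H' K"
  shows "indep_var N X K Y"
proof -
  have "sets H \<subseteq> events" "sets H' \<subseteq> events"
    using indep_setD_ev1[OF assms(1)] indep_setD_ev2[OF assms(1)] .
  then have "X \<in> measurable M N" "Y \<in> measurable M K"
    using measurable_from_subalg[OF _ X] measurable_from_subalg[OF _ Y] assms(2,3)
    by (simp_all add: subalgebra_def)
  moreover have "sigma_sets (space M) {X -` A \<inter> space M |A. A \<in> sets N} \<subseteq> sets H"
    unfolding assms(2)[symmetric] using X by (intro sets.sigma_sets_subset) (auto intro: measurable_sets)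
  moreover have "sigma_sets (space M) {Y -` A \<inter> space M |A. A \<in> sets K} \<subseteq> sets H'"
    unfolding assms(3)[symmetric] using Y by (intro sets.sigma_sets_subset) (auto intro: measurable_sets)
  ultimately show ?thesis
    using assms(1) unfolding indep_var_eq indep_sets2_eq by blast
qed

section \<open>Clipped noisy stochastic gradient descent\<close>

text \<open>Expectation and sum of nonnegative terms commute, and a variable with finite expectation
  is finite almost surely.\<close>

lemma (in prob_space) AE_summable_of_summable_expectation:
  fixes X :: "nat \<Rightarrow> 'a \<Rightarrow> real"
  assumes int: "\<And>n. integrable M (X n)" and nonneg: "\<And>n \<omega>. 0 \<le> X n \<omega>"
    and summ: "summable (\<lambda>n. expectation (X n))"
  shows "AE \<omega> in M. summable (\<lambda>n. X n \<omega>)"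
proof -
  have [measurable]: "X n \<in> borel_measurable M" for n using int by (rule borel_measurable_integrable)
  have e0: "0 \<le> expectation (X n)" for n using nonneg by simp
  have "(\<integral>\<^sup>+\<omega>. (\<Sum>n. ennreal (X n \<omega>)) \<partial>M) = (\<Sum>n. \<integral>\<^sup>+\<omega>. ennreal (X n \<omega>) \<partial>M)"
    by (rule nn_integral_suminf) simp
  also have "\<dots> = (\<Sum>n. ennreal (expectation (X n)))"
    using int nonneg by (simp add: nn_integral_eq_integral)
  also have "\<dots> \<noteq> \<infinity>"
    using suminf_ennreal2[OF e0 summ] by simp
  finally have "AE \<omega> in M. (\<Sum>n. ennreal (X n \<omega>)) \<noteq> \<infinity>"
    by (intro nn_integral_noteq_infinite) auto
  then show ?thesis
    by (rule AE_mp) (auto intro!: AE_I2 summable_suminf_not_top nonneg)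
qed

text \<open>The growth condition on the steps enters the probabilistic argument as summability of
  their squares. \<open>L\<close> is strictly positive because the gradient bound uses a step of
  size \<open>1 / L\<close>.\<close>

locale clipped_noisy_sgd = prob_space M for M :: "'w measure" +
  fixes f :: "'a::euclidean_space \<Rightarrow> real" and gradf :: "'a \<Rightarrow> 'a" and G :: "'a \<Rightarrow> 's \<Rightarrow> 'a"
    and S :: "'s measure" and \<xi> :: "nat \<Rightarrow> 'w \<Rightarrow> 's" and \<zeta> x :: "nat \<Rightarrow> 'w \<Rightarrow> 'a"
    and \<alpha> :: "nat \<Rightarrow> real" and L q fstar \<sigma> s :: real
  assumes fstar_le: "\<And>v. fstar \<le> f v"
    and gradient: "\<And>v. GDERIV f v :> gradf v"
    and lipschitz: "L-lipschitz_on UNIV gradf"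
    and L_pos: "0 < L"
    and G_meas: "(\<lambda>(v, s). G v s) \<in> borel_measurable (borel \<Otimes>\<^sub>M S)"
    and x1_meas: "x 1 \<in> borel_measurable M"
    and xi_meas: "\<And>t. 1 \<le> t \<Longrightarrow> \<xi> t \<in> measurable M S"
    and zeta_meas: "\<And>t. 1 \<le> t \<Longrightarrow> \<zeta> t \<in> borel_measurable M"
    and zeta_gaussian: "\<And>t. 1 \<le> t \<Longrightarrow> distr M borel (\<zeta> t) = isotropic_gaussian s"
    and zeta_indep: "\<And>t. 1 \<le> t \<Longrightarrow> indep_set
          (sets (vimage_algebra (space M) (\<zeta> t) borel))
          (sets (join_rv (sgd_filtration M S (x 1) \<xi> \<zeta> t) S (\<xi> t)))"
    and unbiased: "\<And>t. 1 \<le> t \<Longrightarrow> AE \<omega> in M.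
          vec_cond_exp M (sgd_filtration M S (x 1) \<xi> \<zeta> t)
            (\<lambda>\<omega>'. G (x t \<omega>') (\<xi> t \<omega>')) \<omega> = gradf (x t \<omega>)"
    and sigma: "0 \<le> \<sigma>" "\<sigma> < q"
    and noise_bounded: "\<And>t. 1 \<le> t \<Longrightarrow> AE \<omega> in M.
          norm (G (x t \<omega>) (\<xi> t \<omega>) - gradf (x t \<omega>)) \<le> \<sigma>"
    and alpha_pos: "\<And>t. 1 \<le> t \<Longrightarrow> 0 < \<alpha> t"
    and alpha_summable: "summable (\<lambda>n. (\<alpha> (Suc n))\<^sup>2)"
    and iterates: "\<And>t \<omega>. 1 \<le> t \<Longrightarrow> \<omega> \<in> space M \<Longrightarrow>
          x (Suc t) \<omega> = x t \<omega> - \<alpha> t *\<^sub>R (clip q (G (x t \<omega>) (\<xi> t \<omega>)) + q *\<^sub>R \<zeta> t \<omega>)"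
begin

definition Ft :: "nat \<Rightarrow> 'w measure" where
  "Ft t = sgd_filtration M S (x 1) \<xi> \<zeta> t"

lemma space_Ft [simp]: "space (Ft t) = space M"
  by (simp add: Ft_def)

definition grad :: "nat \<Rightarrow> 'w \<Rightarrow> 'a" where
  "grad t \<omega> = gradf (x t \<omega>)"

definition noise :: "nat \<Rightarrow> 'w \<Rightarrow> 'a" where
  "noise t \<omega> = G (x t \<omega>) (\<xi> t \<omega>) - grad t \<omega>"

text \<open>The initial gap need not be integrable; multiplying by this \<open>Ft 1\<close>-measurable weight
  makes every quantity of the argument integrable without changing almost sure convergence.\<close>

definition weight :: "'w \<Rightarrow> real" where
  "weight \<omega> = 1 / (1 + (f (x 1 \<omega>) - fstar))"

definition gap :: "nat \<Rightarrow> 'w \<Rightarrow> real" where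
  "gap t \<omega> = weight \<omega> * (f (x t \<omega>) - fstar)"

definition slope :: "nat \<Rightarrow> 'w \<Rightarrow> real" where
  "slope t \<omega> = clip_slope q \<sigma> (norm (grad t \<omega>))"

text \<open>The part of the weighted descent inequality that is linear in the two noises. All
  coefficients are \<open>Ft t\<close>-measurable, which is what makes it a martingale
  difference.\<close>

definition incr :: "nat \<Rightarrow> 'w \<Rightarrow> real" where
  "incr t \<omega> = - (\<alpha> t * weight \<omega> * (slope t \<omega> * (grad t \<omega> \<bullet> noise t \<omega>) + q * (grad t \<omega> \<bullet> \<zeta> t \<omega>)))"

text \<open>Bounds the quadratic term of the descent inequality: the step direction has norm at most
  \<open>q * (1 + norm (\<zeta> t \<omega>))\<close>, and the factor 2 from squaring this sum
  cancels the one half. The weight is estimated by 1.\<close>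

definition rem :: "nat \<Rightarrow> 'w \<Rightarrow> real" where
  "rem t \<omega> = L * (\<alpha> t)\<^sup>2 * q\<^sup>2 * (1 + (norm (\<zeta> t \<omega>))\<^sup>2)"

definition second_moment :: real where
  "second_moment = (\<integral>z. (norm z)\<^sup>2 \<partial>(isotropic_gaussian s :: 'a measure))"

section \<open>Elementary bounds and adaptedness\<close>

lemma q_pos: "0 < q" using sigma by linarith

lemma weight_bounds: "0 < weight \<omega>" "weight \<omega> \<le> 1"
  using fstar_le[of "x 1 \<omega>"] by (auto simp: weight_def)

lemma gap_nonneg: "0 \<le> gap t \<omega>"
  using fstar_le[of "x t \<omega>"] weight_bounds[of \<omega>] by (simp add: gap_def)

lemma slope_bounds: "0 \<le> slope t \<omega>" "slope t \<omega> \<le> 2"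
  unfolding slope_def using clip_slope_bounds[OF sigma(1) q_pos] by auto

lemma second_moment_nonneg: "0 \<le> second_moment"
  unfolding second_moment_def by simp

lemma f_meas [measurable]: "f \<in> borel_measurable borel"
proof (rule borel_measurable_continuous_onI, rule continuous_at_imp_continuous_on, rule ballI)
  fix v show "isCont f v"
    using gradient[of v] unfolding gderiv_def by (rule has_derivative_continuous)
qed

lemma gradf_meas [measurable]: "gradf \<in> borel_measurable borel"
  using lipschitz by (intro borel_measurable_continuous_onI lipschitz_on_continuous_on)

lemma clip_meas [measurable]: "clip q \<in> borel_measurable (borel :: 'a measure)"
  unfolding clip_def by measurable

lemma Ft_sub: "subalgebra M (Ft t)"
  unfolding Ft_def by (intro subalgebra_sgd_filtration x1_meas xi_meas zeta_meas)

lemma Ft_mono: "i \<le> t \<Longrightarrow> subalgebra (Ft t) (Ft i)"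
  using sets_sgd_filtration_mono[of i t] by (simp add: subalgebra_def Ft_def)

lemma Ft_xi: "1 \<le> i \<Longrightarrow> i < t \<Longrightarrow> \<xi> i \<in> measurable (Ft t) S"
  and Ft_zeta: "1 \<le> i \<Longrightarrow> i < t \<Longrightarrow> \<zeta> i \<in> borel_measurable (Ft t)"
  and Ft_x1: "x 1 \<in> borel_measurable (Ft t)"
  unfolding Ft_def by (intro sgd_filtration_measurable x1_meas xi_meas zeta_meas; assumption)+

lemma G_comp_meas:
  assumes "X \<in> borel_measurable K" "Y \<in> measurable K S"
  shows "(\<lambda>\<omega>. G (X \<omega>) (Y \<omega>)) \<in> borel_measurable K"
  using measurable_compose[OF measurable_Pair[OF assms] G_meas] by simp

lemma x_meas: "1 \<le> t \<Longrightarrow> x t \<in> borel_measurable (Ft t)"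
proof (induction t rule: nat_induct_at_least)
  case base
  show ?case by (rule Ft_x1)
next
  case (Suc t)
  have [measurable]: "x t \<in> borel_measurable (Ft (Suc t))"
    by (rule measurable_from_subalg[OF Ft_mono Suc.IH]) simp
  have [measurable]: "(\<lambda>\<omega>. G (x t \<omega>) (\<xi> t \<omega>)) \<in> borel_measurable (Ft (Suc t))"
    using Suc.hyps by (intro G_comp_meas Ft_xi) auto
  have [measurable]: "\<zeta> t \<in> borel_measurable (Ft (Suc t))"
    using Suc.hyps by (intro Ft_zeta) auto
  have "(\<lambda>\<omega>. x t \<omega> - \<alpha> t *\<^sub>R (clip q (G (x t \<omega>) (\<xi> t \<omega>)) + q *\<^sub>R \<zeta> t \<omega>))
      \<in> borel_measurable (Ft (Suc t))"
    by measurable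
  then show ?case
    using iterates[OF Suc.hyps] by (subst measurable_cong) auto
qed

lemma adapted:
  assumes "1 \<le> t" "t \<le> n"
  shows "x t \<in> borel_measurable (Ft n)" "weight \<in> borel_measurable (Ft n)"
    "gap t \<in> borel_measurable (Ft n)" "grad t \<in> borel_measurable (Ft n)"
    "slope t \<in> borel_measurable (Ft n)"
proof -
  show [measurable]: "x t \<in> borel_measurable (Ft n)"
    using measurable_from_subalg[OF Ft_mono x_meas] assms by blast
  note Ft_x1[of n, measurable]
  show [measurable]: "weight \<in> borel_measurable (Ft n)"
    unfolding weight_def by measurable
  show "gap t \<in> borel_measurable (Ft n)"
    unfolding gap_def by measurable
  show [measurable]: "grad t \<in> borel_measurable (Ft n)"
    unfolding grad_def by measurable
  show "slope t \<in> borel_measurable (Ft n)"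
    unfolding slope_def clip_slope_def by measurable
qed

lemmas meas_M = measurable_from_subalg[OF Ft_sub adapted(1)] measurable_from_subalg[OF Ft_sub adapted(2)]
  measurable_from_subalg[OF Ft_sub adapted(3)] measurable_from_subalg[OF Ft_sub adapted(4)]
  measurable_from_subalg[OF Ft_sub adapted(5)]

lemma weight_meas [measurable]: "weight \<in> borel_measurable M"
  using meas_M(2)[of 1 1] by simp

lemma x_meas_M: "1 \<le> t \<Longrightarrow> x t \<in> borel_measurable M"
  and gap_meas: "1 \<le> t \<Longrightarrow> gap t \<in> borel_measurable M"
  and grad_meas: "1 \<le> t \<Longrightarrow> grad t \<in> borel_measurable M"
  and slope_meas: "1 \<le> t \<Longrightarrow> slope t \<in> borel_measurable M"
  using meas_M[of t t] by simp_all

lemma G_meas_M: "1 \<le> t \<Longrightarrow> (\<lambda>\<omega>. G (x t \<omega>) (\<xi> t \<omega>)) \<in> borel_measurable M"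
  by (intro G_comp_meas x_meas_M xi_meas)

lemma noise_meas: "1 \<le> t \<Longrightarrow> noise t \<in> borel_measurable M"
  unfolding noise_def using G_meas_M grad_meas by simp

lemma incr_adapted:
  assumes "1 \<le> t"
  shows "incr t \<in> borel_measurable (Ft (Suc t))"
proof -
  note adapted[OF assms, of "Suc t", simplified, measurable]
  have [measurable]: "\<zeta> t \<in> borel_measurable (Ft (Suc t))" by (intro Ft_zeta assms) simp
  have [measurable]: "(\<lambda>\<omega>. G (x t \<omega>) (\<xi> t \<omega>)) \<in> borel_measurable (Ft (Suc t))"
    by (intro G_comp_meas Ft_xi assms) (simp_all add: \<open>x t \<in> _\<close>)
  show ?thesis unfolding incr_def noise_def by measurable
qed

lemma incr_meas: "1 \<le> t \<Longrightarrow> incr t \<in> borel_measurable M"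
  using measurable_from_subalg[OF Ft_sub incr_adapted] .

lemma AE_noise: "1 \<le> t \<Longrightarrow> AE \<omega> in M. norm (noise t \<omega>) \<le> \<sigma>"
  using noise_bounded[of t] by (simp add: noise_def grad_def)

section \<open>Pathwise descent of the weighted gap\<close>

lemma gap_step:
  assumes "1 \<le> t"
  shows "AE \<omega> in M. gap (Suc t) \<omega>
    \<le> gap t \<omega> - weight \<omega> / 4 * (\<alpha> t * Psi q (norm (grad t \<omega>))) + (incr t \<omega> + rem t \<omega>)"
  using AE_noise[OF assms]
proof (rule AE_mp, intro AE_I2 impI)
  fix \<omega> assume \<omega>: "\<omega> \<in> space M" and N: "norm (noise t \<omega>) \<le> \<sigma>"
  define a where "a = \<alpha> t"
  define v where "v = grad t \<omega>"
  define z where "z = \<zeta> t \<omega>"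
  define g where "g = clip q (v + noise t \<omega>) + q *\<^sub>R z"
  define w where "w = weight \<omega>"
  have a: "0 < a" using alpha_pos[OF assms] by (simp add: a_def)
  have w: "0 < w" "w \<le> 1" using weight_bounds by (auto simp: w_def)
  have step: "x (Suc t) \<omega> - x t \<omega> = - (a *\<^sub>R g)"
    using iterates[OF assms \<omega>] by (simp add: g_def z_def v_def noise_def a_def)
  have "f (x (Suc t) \<omega>) \<le> f (x t \<omega>) + v \<bullet> (- (a *\<^sub>R g)) + L / 2 * (norm (- (a *\<^sub>R g)))\<^sup>2"
    using gderiv_quadratic_upper_bound[OF gradient lipschitz, of "x (Suc t) \<omega>" "x t \<omega>"]
    unfolding step by (simp add: v_def grad_def)
  also have "\<dots> = f (x t \<omega>) - a * (v \<bullet> clip q (v + noise t \<omega>)) - a * q * (v \<bullet> z) + L / 2 * a\<^sup>2 * (norm g)\<^sup>2"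
    using a by (simp add: power_mult_distrib) (simp add: g_def inner_add_right algebra_simps)
  finally have 1: "f (x (Suc t) \<omega>) \<le> f (x t \<omega>) - a * (v \<bullet> clip q (v + noise t \<omega>)) - a * q * (v \<bullet> z)
      + L / 2 * a\<^sup>2 * (norm g)\<^sup>2" .
  have 2: "a * (Psi q (norm v) / 4 + slope t \<omega> * (v \<bullet> noise t \<omega>)) \<le> a * (v \<bullet> clip q (v + noise t \<omega>))"
    using inner_clip_ge[OF sigma N, of v] a by (simp add: slope_def v_def)
  have "norm g \<le> q + q * norm z"
    unfolding g_def using norm_triangle_ineq[of "clip q (v + noise t \<omega>)" "q *\<^sub>R z"] norm_clip_le[of q "v + noise t \<omega>"] q_pos
    by simp
  then have "(norm g)\<^sup>2 \<le> (q + q * norm z)\<^sup>2" by (intro power_mono) auto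
  also have "\<dots> \<le> 2 * (q\<^sup>2 * (1 + (norm z)\<^sup>2))"
    using sum_squares_bound[of q "q * norm z"] by (simp add: power2_sum power_mult_distrib algebra_simps)
  finally have "L / 2 * a\<^sup>2 * (norm g)\<^sup>2 \<le> L / 2 * a\<^sup>2 * (2 * (q\<^sup>2 * (1 + (norm z)\<^sup>2)))"
    using L_pos by (intro mult_left_mono) auto
  then have 3: "L / 2 * a\<^sup>2 * (norm g)\<^sup>2 \<le> rem t \<omega>"
    by (simp add: rem_def a_def z_def mult.assoc)
  have rem0: "0 \<le> rem t \<omega>" using L_pos by (simp add: rem_def)
  have "f (x (Suc t) \<omega>) - fstar \<le> (f (x t \<omega>) - fstar) - a * Psi q (norm v) / 4
      - a * (slope t \<omega> * (v \<bullet> noise t \<omega>) + q * (v \<bullet> z)) + rem t \<omega>"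
    using 1 2 3 by (simp add: algebra_simps)
  then have "w * (f (x (Suc t) \<omega>) - fstar) \<le> w * ((f (x t \<omega>) - fstar) - a * Psi q (norm v) / 4
      - a * (slope t \<omega> * (v \<bullet> noise t \<omega>) + q * (v \<bullet> z)) + rem t \<omega>)"
    using w by (intro mult_left_mono) auto
  also have "\<dots> = w * (f (x t \<omega>) - fstar) - w / 4 * (a * Psi q (norm v)) + incr t \<omega> + w * rem t \<omega>"
    by (simp add: incr_def w_def a_def v_def z_def algebra_simps)
  also have "w * rem t \<omega> \<le> rem t \<omega>" using w rem0 by (intro mult_left_le_one_le) auto
  finally show "gap (Suc t) \<omega> \<le> gap t \<omega> - weight \<omega> / 4 * (\<alpha> t * Psi q (norm (grad t \<omega>))) + (incr t \<omega> + rem t \<omega>)"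
    by (simp add: gap_def w_def a_def v_def)
qed

section \<open>Centering and moments of the increments\<close>

text \<open>The conditional mean is known for the stochastic gradient, which need not be integrable.
  A factor \<open>Z\<close> that is integrable both alone and against the gradient makes
  \<open>Z\<close> times the stochastic gradient integrable, so \<open>Z\<close> can be pulled out;
  subtracting the gradient part leaves the noise.\<close>

lemma noise_orthogonal:
  assumes "1 \<le> t" "b \<in> Basis" and Z: "Z \<in> borel_measurable (Ft t)"
    and int: "integrable M Z" "integrable M (\<lambda>\<omega>. Z \<omega> * (grad t \<omega> \<bullet> b))"
  shows "integrable M (\<lambda>\<omega>. Z \<omega> * (noise t \<omega> \<bullet> b))" "expectation (\<lambda>\<omega>. Z \<omega> * (noise t \<omega> \<bullet> b)) = 0"
proof -
  interpret Fsub: finite_measure_subalgebra M "Ft t" by unfold_locales (rule Ft_sub)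
  note [measurable] = noise_meas[OF assms(1)] grad_meas[OF assms(1)] G_meas_M[OF assms(1)]
  have [measurable]: "Z \<in> borel_measurable M" using int(1) by simp
  show i1: "integrable M (\<lambda>\<omega>. Z \<omega> * (noise t \<omega> \<bullet> b))"
  proof (rule Bochner_Integration.integrable_bound)
    show "integrable M (\<lambda>\<omega>. \<sigma> * \<bar>Z \<omega>\<bar>)" using int(1) by simp
    show "AE \<omega> in M. norm (Z \<omega> * (noise t \<omega> \<bullet> b)) \<le> norm (\<sigma> * \<bar>Z \<omega>\<bar>)"
      using AE_noise[OF assms(1)]
    proof (rule AE_mp, intro AE_I2 impI)
      fix \<omega> assume "norm (noise t \<omega>) \<le> \<sigma>"
      then have "\<bar>noise t \<omega> \<bullet> b\<bar> \<le> \<sigma>" using Basis_le_norm[OF assms(2), of "noise t \<omega>"] by linarith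
      then show "norm (Z \<omega> * (noise t \<omega> \<bullet> b)) \<le> norm (\<sigma> * \<bar>Z \<omega>\<bar>)"
        using sigma by (simp add: abs_mult mult.commute[of \<sigma>] mult_left_mono)
    qed
  qed simp
  have eq: "Z \<omega> * (G (x t \<omega>) (\<xi> t \<omega>) \<bullet> b) = Z \<omega> * (grad t \<omega> \<bullet> b) + Z \<omega> * (noise t \<omega> \<bullet> b)" for \<omega>
    by (simp add: noise_def inner_diff_left algebra_simps)
  have i2: "integrable M (\<lambda>\<omega>. Z \<omega> * (G (x t \<omega>) (\<xi> t \<omega>) \<bullet> b))"
    unfolding eq using i1 int by simp
  have ce: "AE \<omega> in M. real_cond_exp M (Ft t) (\<lambda>\<omega>. G (x t \<omega>) (\<xi> t \<omega>) \<bullet> b) \<omega> = grad t \<omega> \<bullet> b"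
    using unbiased[OF assms(1), folded Ft_def]
  proof (rule AE_mp, intro AE_I2 impI)
    fix \<omega> assume "vec_cond_exp M (Ft t) (\<lambda>\<omega>'. G (x t \<omega>') (\<xi> t \<omega>')) \<omega> = gradf (x t \<omega>)"
    from arg_cong[OF this, of "\<lambda>v. v \<bullet> b"]
    show "real_cond_exp M (Ft t) (\<lambda>\<omega>. G (x t \<omega>) (\<xi> t \<omega>) \<bullet> b) \<omega> = grad t \<omega> \<bullet> b"
      unfolding vec_cond_exp_def inner_sum_left_Basis[OF assms(2)] grad_def .
  qed
  have "expectation (\<lambda>\<omega>. Z \<omega> * (G (x t \<omega>) (\<xi> t \<omega>) \<bullet> b))
      = expectation (\<lambda>\<omega>. Z \<omega> * real_cond_exp M (Ft t) (\<lambda>\<omega>. G (x t \<omega>) (\<xi> t \<omega>) \<bullet> b) \<omega>)"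
    using Fsub.real_cond_exp_intg(2)[OF i2 Z] by simp
  also have "\<dots> = expectation (\<lambda>\<omega>. Z \<omega> * (grad t \<omega> \<bullet> b))"
    using ce by (intro integral_cong_AE) auto
  finally show "expectation (\<lambda>\<omega>. Z \<omega> * (noise t \<omega> \<bullet> b)) = 0"
    unfolding eq using i1 int by simp
qed

lemma zeta_moments:
  assumes "1 \<le> t"
  shows "integrable M (\<lambda>\<omega>. (norm (\<zeta> t \<omega>))\<^sup>2)"
    "expectation (\<lambda>\<omega>. (norm (\<zeta> t \<omega>))\<^sup>2) = second_moment"
    "integrable M (\<lambda>\<omega>. \<zeta> t \<omega> \<bullet> b)" "expectation (\<lambda>\<omega>. \<zeta> t \<omega> \<bullet> b) = 0"
proof -
  note [measurable] = zeta_meas[OF assms]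
  show i: "integrable M (\<lambda>\<omega>. (norm (\<zeta> t \<omega>))\<^sup>2)"
    using isotropic_gaussian_integrable_norm_square[of s, where 'a='a]
    unfolding zeta_gaussian[OF assms, symmetric] by (subst (asm) integrable_distr_eq) auto
  show "expectation (\<lambda>\<omega>. (norm (\<zeta> t \<omega>))\<^sup>2) = second_moment"
    unfolding second_moment_def zeta_gaussian[OF assms, symmetric] by (subst integral_distr) auto
  show "expectation (\<lambda>\<omega>. \<zeta> t \<omega> \<bullet> b) = 0"
    using isotropic_gaussian_mean_zero[where b=b and s=s]
    unfolding zeta_gaussian[OF assms, symmetric] by (subst (asm) integral_distr) auto
  show "integrable M (\<lambda>\<omega>. \<zeta> t \<omega> \<bullet> b)"
  proof (rule Bochner_Integration.integrable_bound)
    show "integrable M (\<lambda>\<omega>. (1 + (norm (\<zeta> t \<omega>))\<^sup>2) * norm b)" using i by simp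
    have "\<bar>z \<bullet> b\<bar> \<le> (1 + (norm z)\<^sup>2) * norm b" for z :: 'a
    proof -
      have "2 * norm z \<le> 1 + (norm z)\<^sup>2" using sum_squares_bound[of 1 "norm z"] by simp
      then have "norm z \<le> 1 + (norm z)\<^sup>2" using norm_ge_zero[of z] by linarith
      then show ?thesis using Cauchy_Schwarz_ineq2[of z b] by (meson mult_right_mono norm_ge_zero order_trans)
    qed
    then show "AE \<omega> in M. norm (\<zeta> t \<omega> \<bullet> b) \<le> norm ((1 + (norm (\<zeta> t \<omega>))\<^sup>2) * norm b)"
      by (simp add: abs_mult)
  qed simp
qed

text \<open>The linear products center the Gaussian part of \<open>incr\<close>; the quadratic ones,
  with \<open>gap t\<close> as \<open>Z\<close>, bound its second moment.\<close>

lemma zeta_indep_products: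
  assumes "1 \<le> t" and Z: "Z \<in> borel_measurable (Ft t)" and int: "integrable M Z"
  shows "integrable M (\<lambda>\<omega>. Z \<omega> * (\<zeta> t \<omega> \<bullet> b))" "expectation (\<lambda>\<omega>. Z \<omega> * (\<zeta> t \<omega> \<bullet> b)) = 0"
    "integrable M (\<lambda>\<omega>. Z \<omega> * (norm (\<zeta> t \<omega>))\<^sup>2)"
    "expectation (\<lambda>\<omega>. Z \<omega> * (norm (\<zeta> t \<omega>))\<^sup>2) = expectation Z * second_moment"
proof -
  have indep: "indep_var borel (\<lambda>\<omega>. h (\<zeta> t \<omega>)) borel Z" if "h \<in> borel_measurable borel" for h :: "'a \<Rightarrow> real"
  proof (rule indep_var_of_indep_sigma[OF zeta_indep[OF assms(1), folded Ft_def]])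
    show "(\<lambda>\<omega>. h (\<zeta> t \<omega>)) \<in> borel_measurable (vimage_algebra (space M) (\<zeta> t) borel)"
      using that by (rule measurable_compose[rotated]) (simp add: measurable_vimage_algebra1)
    show "Z \<in> borel_measurable (join_rv (Ft t) S (\<xi> t))"
      by (rule measurable_from_subalg[OF subalgebra_join_rv Z])
  qed (simp_all add: join_rv_def space_measure_of_conv)
  have b: "indep_var borel (\<lambda>\<omega>. \<zeta> t \<omega> \<bullet> b) borel Z" by (rule indep) simp
  have n: "indep_var borel (\<lambda>\<omega>. (norm (\<zeta> t \<omega>))\<^sup>2) borel Z" by (rule indep) simp
  show "integrable M (\<lambda>\<omega>. Z \<omega> * (\<zeta> t \<omega> \<bullet> b))" "expectation (\<lambda>\<omega>. Z \<omega> * (\<zeta> t \<omega> \<bullet> b)) = 0"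
    using indep_var_integrable[OF b zeta_moments(3)[OF assms(1)] int]
      indep_var_lebesgue_integral[OF b zeta_moments(3)[OF assms(1)] int] zeta_moments(4)[OF assms(1)]
    by (simp_all add: mult.commute)
  show "integrable M (\<lambda>\<omega>. Z \<omega> * (norm (\<zeta> t \<omega>))\<^sup>2)"
    "expectation (\<lambda>\<omega>. Z \<omega> * (norm (\<zeta> t \<omega>))\<^sup>2) = expectation Z * second_moment"
    using indep_var_integrable[OF n zeta_moments(1)[OF assms(1)] int]
      indep_var_lebesgue_integral[OF n zeta_moments(1)[OF assms(1)] int] zeta_moments(2)[OF assms(1)]
    by (simp_all add: mult.commute)
qed

lemma weighted_gradient_square_le: "weight \<omega> * (norm (grad t \<omega>))\<^sup>2 \<le> 2 * L * gap t \<omega>"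
proof -
  have "weight \<omega> * (norm (grad t \<omega>))\<^sup>2 \<le> weight \<omega> * (2 * L * (f (x t \<omega>) - fstar))"
    unfolding grad_def using weight_bounds[of \<omega>]
    by (intro mult_left_mono norm_gradient_squared_le[OF gradient lipschitz L_pos fstar_le]) auto
  then show ?thesis by (simp add: gap_def algebra_simps)
qed

lemma weighted_gradient_integrable:
  assumes "1 \<le> t" and gap: "integrable M (gap t)"
  shows "integrable M (\<lambda>\<omega>. weight \<omega> * (norm (grad t \<omega>))\<^sup>2)" "integrable M (\<lambda>\<omega>. weight \<omega> * norm (grad t \<omega>))"
proof -
  note [measurable] = grad_meas[OF assms(1)]
  show i: "integrable M (\<lambda>\<omega>. weight \<omega> * (norm (grad t \<omega>))\<^sup>2)"
  proof (rule Bochner_Integration.integrable_bound)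
    show "integrable M (\<lambda>\<omega>. 2 * L * gap t \<omega>)" using gap by simp
    show "AE \<omega> in M. norm (weight \<omega> * (norm (grad t \<omega>))\<^sup>2) \<le> norm (2 * L * gap t \<omega>)"
      using weighted_gradient_square_le weight_bounds(1) gap_nonneg L_pos
      by (auto simp: abs_mult less_imp_le)
  qed simp
  show "integrable M (\<lambda>\<omega>. weight \<omega> * norm (grad t \<omega>))"
  proof (rule Bochner_Integration.integrable_bound)
    show "integrable M (\<lambda>\<omega>. 1 + weight \<omega> * (norm (grad t \<omega>))\<^sup>2)" using i by simp
    have "w * r \<le> 1 + w * r\<^sup>2" if "0 < w" "w \<le> 1" for w r :: real
    proof -
      have "2 * r \<le> 1 + r\<^sup>2" using sum_squares_bound[of 1 r] by simp
      then have "w * (2 * r) \<le> w * (1 + r\<^sup>2)" using that by (intro mult_left_mono) auto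
      moreover have "0 \<le> w * r\<^sup>2" using that by simp
      moreover have "w * (2 * r) = 2 * (w * r)" "w * (1 + r\<^sup>2) = w + w * r\<^sup>2"
        by (simp_all add: algebra_simps)
      ultimately show ?thesis using that by linarith
    qed
    then show "AE \<omega> in M. norm (weight \<omega> * norm (grad t \<omega>)) \<le> norm (1 + weight \<omega> * (norm (grad t \<omega>))\<^sup>2)"
      using weight_bounds by (auto simp: abs_mult less_imp_le add_nonneg_nonneg)
  qed simp
qed

text \<open>The test function \<open>U\<close> covers two uses: the constant 1 gives mean zero, and
  indicators of sets of \<open>Ft t\<close> identify the conditional expectation.\<close>

lemma incr_orthogonal:
  assumes t: "1 \<le> t" and gap: "integrable M (gap t)"
    and U: "U \<in> borel_measurable (Ft t)" "\<And>\<omega>. \<bar>U \<omega>\<bar> \<le> 1"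
  shows "integrable M (\<lambda>\<omega>. U \<omega> * incr t \<omega>)" "expectation (\<lambda>\<omega>. U \<omega> * incr t \<omega>) = 0"
proof -
  note wi = weighted_gradient_integrable[OF assms(1,2)]
  note [measurable] = grad_meas[OF t] slope_meas[OF t]
  have [measurable]: "U \<in> borel_measurable M" using measurable_from_subalg[OF Ft_sub U(1)] .
  have a: "0 < \<alpha> t" using alpha_pos[OF t] .
  \<comment> \<open>The coefficients of the noise coordinates in \<open>U * incr t\<close>;
    coordinates are needed because conditional expectations of vectors are taken
    componentwise.\<close>
  define Z1 where "Z1 b \<omega> = - (\<alpha> t * U \<omega> * slope t \<omega> * weight \<omega>) * (grad t \<omega> \<bullet> b)" for b \<omega>
  define Z2 where "Z2 b \<omega> = - (\<alpha> t * q * U \<omega> * weight \<omega>) * (grad t \<omega> \<bullet> b)" for b \<omega>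
  have ZF: "Z1 b \<in> borel_measurable (Ft t)" "Z2 b \<in> borel_measurable (Ft t)" for b
    unfolding Z1_def Z2_def using adapted[OF t order_refl] U(1) by measurable
  have [measurable]: "Z1 b \<in> borel_measurable M" "Z2 b \<in> borel_measurable M" for b
    using measurable_from_subalg[OF Ft_sub ZF(1)] measurable_from_subalg[OF Ft_sub ZF(2)] .
  have bd: "\<bar>Z1 b \<omega>\<bar> \<le> 2 * \<alpha> t * (weight \<omega> * norm (grad t \<omega>))"
    "\<bar>Z2 b \<omega>\<bar> \<le> \<alpha> t * q * (weight \<omega> * norm (grad t \<omega>))" if "b \<in> Basis" for b \<omega>
  proof -
    have gb: "\<bar>grad t \<omega> \<bullet> b\<bar> \<le> norm (grad t \<omega>)" by (rule Basis_le_norm[OF that])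
    have us: "\<bar>U \<omega>\<bar> * slope t \<omega> \<le> 1 * 2" using U(2) slope_bounds by (intro mult_mono) auto
    have "\<bar>Z1 b \<omega>\<bar> = (\<alpha> t * weight \<omega>) * ((\<bar>U \<omega>\<bar> * slope t \<omega>) * \<bar>grad t \<omega> \<bullet> b\<bar>)"
      using a weight_bounds(1)[of \<omega>] slope_bounds(1)[of t \<omega>] by (simp add: Z1_def abs_mult mult_ac)
    also have "\<dots> \<le> (\<alpha> t * weight \<omega>) * ((1 * 2) * norm (grad t \<omega>))"
      using a weight_bounds(1)[of \<omega>] by (intro mult_left_mono[OF mult_mono[OF us gb]]) auto
    finally show "\<bar>Z1 b \<omega>\<bar> \<le> 2 * \<alpha> t * (weight \<omega> * norm (grad t \<omega>))" by (simp add: mult_ac)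
    have "\<bar>Z2 b \<omega>\<bar> = (\<alpha> t * q * weight \<omega>) * (\<bar>U \<omega>\<bar> * \<bar>grad t \<omega> \<bullet> b\<bar>)"
      using a weight_bounds(1)[of \<omega>] q_pos by (simp add: Z2_def abs_mult mult_ac)
    also have "\<dots> \<le> (\<alpha> t * q * weight \<omega>) * (1 * norm (grad t \<omega>))"
      using a weight_bounds(1)[of \<omega>] q_pos U(2) gb by (intro mult_left_mono mult_mono) auto
    finally show "\<bar>Z2 b \<omega>\<bar> \<le> \<alpha> t * q * (weight \<omega> * norm (grad t \<omega>))" by (simp add: mult_ac)
  qed
  have i1: "integrable M (Z1 b)" if "b \<in> Basis" for b
  proof (rule Bochner_Integration.integrable_bound)
    show "integrable M (\<lambda>\<omega>. 2 * \<alpha> t * (weight \<omega> * norm (grad t \<omega>)))" using wi by simp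
    show "AE \<omega> in M. norm (Z1 b \<omega>) \<le> norm (2 * \<alpha> t * (weight \<omega> * norm (grad t \<omega>)))"
      using bd(1)[OF that] by (auto intro!: AE_I2 order_trans[OF _ abs_ge_self])
  qed simp
  have i2: "integrable M (Z2 b)" if "b \<in> Basis" for b
  proof (rule Bochner_Integration.integrable_bound)
    show "integrable M (\<lambda>\<omega>. \<alpha> t * q * (weight \<omega> * norm (grad t \<omega>)))" using wi by simp
    show "AE \<omega> in M. norm (Z2 b \<omega>) \<le> norm (\<alpha> t * q * (weight \<omega> * norm (grad t \<omega>)))"
      using bd(2)[OF that] by (auto intro!: AE_I2 order_trans[OF _ abs_ge_self])
  qed simp
  \<comment> \<open>\<open>noise_orthogonal\<close> asks for integrability against the gradient,
    which is quadratic in the gradient and hence controlled by the weighted gap.\<close>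
  have i3: "integrable M (\<lambda>\<omega>. Z1 b \<omega> * (grad t \<omega> \<bullet> b))" if "b \<in> Basis" for b
  proof (rule Bochner_Integration.integrable_bound)
    show "integrable M (\<lambda>\<omega>. 2 * \<alpha> t * (weight \<omega> * (norm (grad t \<omega>))\<^sup>2))" using wi by simp
    have "\<bar>Z1 b \<omega> * (grad t \<omega> \<bullet> b)\<bar> \<le> 2 * \<alpha> t * (weight \<omega> * (norm (grad t \<omega>))\<^sup>2)" for \<omega>
    proof -
      have "\<bar>Z1 b \<omega>\<bar> * \<bar>grad t \<omega> \<bullet> b\<bar> \<le> 2 * \<alpha> t * (weight \<omega> * norm (grad t \<omega>)) * norm (grad t \<omega>)"
        using a weight_bounds(1)[of \<omega>] bd(1)[OF that] Basis_le_norm[OF that] by (intro mult_mono) auto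
      then show ?thesis by (simp add: abs_mult power2_eq_square mult_ac)
    qed
    then show "AE \<omega> in M. norm (Z1 b \<omega> * (grad t \<omega> \<bullet> b)) \<le> norm (2 * \<alpha> t * (weight \<omega> * (norm (grad t \<omega>))\<^sup>2))"
      by (auto intro!: AE_I2 order_trans[OF _ abs_ge_self])
  qed simp
  have eq: "U \<omega> * incr t \<omega> = (\<Sum>b\<in>Basis. Z1 b \<omega> * (noise t \<omega> \<bullet> b) + Z2 b \<omega> * (\<zeta> t \<omega> \<bullet> b))" for \<omega>
  proof -
    have "U \<omega> * incr t \<omega> = - (\<alpha> t * U \<omega> * slope t \<omega> * weight \<omega>) * (grad t \<omega> \<bullet> noise t \<omega>)
        + - (\<alpha> t * q * U \<omega> * weight \<omega>) * (grad t \<omega> \<bullet> \<zeta> t \<omega>)"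
      by (simp add: incr_def algebra_simps)
    also have "\<dots> = (\<Sum>b\<in>Basis. Z1 b \<omega> * (noise t \<omega> \<bullet> b)) + (\<Sum>b\<in>Basis. Z2 b \<omega> * (\<zeta> t \<omega> \<bullet> b))"
      by (simp only: Z1_def Z2_def mult.assoc euclidean_inner[of "grad t \<omega>" "noise t \<omega>"]
          euclidean_inner[of "grad t \<omega>" "\<zeta> t \<omega>"] sum_distrib_left)
    finally show ?thesis by (simp add: sum.distrib)
  qed
  note n = noise_orthogonal[OF t _ ZF(1) i1 i3] and z = zeta_indep_products(1,2)[OF t ZF(2) i2]
  show "integrable M (\<lambda>\<omega>. U \<omega> * incr t \<omega>)"
    unfolding eq by (intro Bochner_Integration.integrable_sum Bochner_Integration.integrable_add n z)
  show "expectation (\<lambda>\<omega>. U \<omega> * incr t \<omega>) = 0"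
    unfolding eq by (subst Bochner_Integration.integral_sum) (auto simp: n z)
qed

lemma incr_centered:
  assumes "1 \<le> t" "integrable M (gap t)"
  shows "integrable M (incr t)" "expectation (incr t) = 0"
    "AE \<omega> in M. real_cond_exp M (Ft t) (incr t) \<omega> = 0"
proof -
  interpret Fsub: finite_measure_subalgebra M "Ft t" by unfold_locales (rule Ft_sub)
  show i: "integrable M (incr t)" "expectation (incr t) = 0"
    using incr_orthogonal[OF assms, of "\<lambda>_. 1"] by simp_all
  show "AE \<omega> in M. real_cond_exp M (Ft t) (incr t) \<omega> = 0"
  proof (rule Fsub.real_cond_exp_charact)
    fix A assume "A \<in> sets (Ft t)"
    then have "expectation (\<lambda>\<omega>. indicator A \<omega> * incr t \<omega>) = 0"
      by (intro incr_orthogonal assms) (auto simp: indicator_def)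
    then show "(LINT \<omega>:A|M. incr t \<omega>) = (LINT \<omega>:A|M. 0)"
      by (simp add: set_lebesgue_integral_def)
  qed (use i in auto)
qed

lemma rem_moments:
  assumes "1 \<le> t"
  shows "integrable M (rem t)" "expectation (rem t) = L * q\<^sup>2 * (1 + second_moment) * (\<alpha> t)\<^sup>2"
  unfolding rem_def using zeta_moments[OF assms] by (simp_all add: prob_space)

text \<open>The leading 1 bounds the weighted initial gap; the rest is the sum of all expected
  remainders.\<close>

definition gap_bound :: real where
  "gap_bound = 1 + L * q\<^sup>2 * (1 + second_moment) * (\<Sum>n. (\<alpha> (Suc n))\<^sup>2)"

text \<open>Centering the increment at one time requires integrability of the gap at that time, and
  a centered increment carries integrability and the bound to the next gap. Hence a joint induction,
  with the nonnegative \<open>Psi\<close> term discarded.\<close>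

lemma gap_integrable_le:
  "integrable M (gap (Suc n)) \<and>
    expectation (gap (Suc n)) \<le> 1 + L * q\<^sup>2 * (1 + second_moment) * (\<Sum>i<n. (\<alpha> (Suc i))\<^sup>2)"
proof (induction n)
  case 0
  have "gap 1 \<omega> \<le> 1" for \<omega>
    using fstar_le[of "x 1 \<omega>"] by (simp add: gap_def weight_def)
  then have "integrable M (gap 1)" "expectation (gap 1) \<le> 1"
    using gap_nonneg[of 1] gap_meas[of 1]
    by (auto intro!: integrable_const_bound[of _ 1] integral_le_const)
  then show ?case by simp
next
  case (Suc n)
  let ?t = "Suc n"
  have t: "1 \<le> ?t" by simp
  note c = incr_centered[OF t conjunct1[OF Suc.IH]] and r = rem_moments[OF t]
  have i: "integrable M (\<lambda>\<omega>. gap ?t \<omega> + (incr ?t \<omega> + rem ?t \<omega>))"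
    using Suc.IH c r by simp
  have le: "AE \<omega> in M. gap (Suc ?t) \<omega> \<le> gap ?t \<omega> + (incr ?t \<omega> + rem ?t \<omega>)"
    using gap_step[OF t]
  proof (rule AE_mp, intro AE_I2 impI)
    fix \<omega>
    assume "gap (Suc ?t) \<omega> \<le> gap ?t \<omega> - weight \<omega> / 4 * (\<alpha> ?t * Psi q (norm (grad ?t \<omega>))) + (incr ?t \<omega> + rem ?t \<omega>)"
    moreover have "0 \<le> weight \<omega> / 4 * (\<alpha> ?t * Psi q (norm (grad ?t \<omega>)))"
      using weight_bounds(1)[of \<omega>] alpha_pos[OF t] q_pos by (intro mult_nonneg_nonneg Psi_nonneg) auto
    ultimately show "gap (Suc ?t) \<omega> \<le> gap ?t \<omega> + (incr ?t \<omega> + rem ?t \<omega>)" by linarith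
  qed
  have int: "integrable M (gap (Suc ?t))"
  proof (rule Bochner_Integration.integrable_bound[OF i])
    show "AE \<omega> in M. norm (gap (Suc ?t) \<omega>) \<le> norm (gap ?t \<omega> + (incr ?t \<omega> + rem ?t \<omega>))"
      using le
    proof eventually_elim
      case (elim \<omega>)
      then show ?case
        using gap_nonneg[of "Suc ?t" \<omega>] by simp
    qed
  qed (simp add: gap_meas)
  have "expectation (gap (Suc ?t)) \<le> expectation (\<lambda>\<omega>. gap ?t \<omega> + (incr ?t \<omega> + rem ?t \<omega>))"
    by (rule integral_mono_AE[OF int i le])
  also have "\<dots> = expectation (gap ?t) + L * q\<^sup>2 * (1 + second_moment) * (\<alpha> ?t)\<^sup>2"
    using Suc.IH c r by simp
  finally show ?case using int Suc.IH by (simp add: algebra_simps)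
qed

lemma gap_integrable: "1 \<le> t \<Longrightarrow> integrable M (gap t)"
  and gap_expectation_le: "1 \<le> t \<Longrightarrow> expectation (gap t) \<le> gap_bound"
proof -
  assume "1 \<le> t"
  then obtain n where n: "t = Suc n" by (cases t) auto
  show "integrable M (gap t)" unfolding n using gap_integrable_le by blast
  have "(\<Sum>i<n. (\<alpha> (Suc i))\<^sup>2) \<le> (\<Sum>n. (\<alpha> (Suc n))\<^sup>2)"
    using alpha_summable by (intro sum_le_suminf) auto
  then have "L * q\<^sup>2 * (1 + second_moment) * (\<Sum>i<n. (\<alpha> (Suc i))\<^sup>2)
      \<le> L * q\<^sup>2 * (1 + second_moment) * (\<Sum>n. (\<alpha> (Suc n))\<^sup>2)"
    using L_pos second_moment_nonneg by (intro mult_left_mono) auto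
  then show "expectation (gap t) \<le> gap_bound"
    unfolding n gap_bound_def using gap_integrable_le[of n] by linarith
qed

text \<open>The square is quadratic in the gradient and so linear in the gap: its expectation needs
  no second moment of the gap.\<close>

lemma incr_square:
  assumes t: "1 \<le> t"
  shows "integrable M (\<lambda>\<omega>. (incr t \<omega>)\<^sup>2)"
    "expectation (\<lambda>\<omega>. (incr t \<omega>)\<^sup>2) \<le> 2 * L * (8 * \<sigma>\<^sup>2 + 2 * q\<^sup>2 * second_moment) * gap_bound * (\<alpha> t)\<^sup>2"
proof -
  note [measurable] = incr_meas[OF t]
  define B where "B \<omega> = (\<alpha> t)\<^sup>2 * (2 * L) * (8 * \<sigma>\<^sup>2 * gap t \<omega> + 2 * q\<^sup>2 * (gap t \<omega> * (norm (\<zeta> t \<omega>))\<^sup>2))" for \<omega>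
  note gi = gap_integrable[OF t]
  note gz = zeta_indep_products(3,4)[OF t adapted(3)[OF t order_refl] gi]
  have Bi: "integrable M B" unfolding B_def using gi gz by simp
  have "expectation B = (\<alpha> t)\<^sup>2 * (2 * L)
      * (8 * \<sigma>\<^sup>2 * expectation (gap t) + 2 * q\<^sup>2 * expectation (\<lambda>\<omega>. gap t \<omega> * (norm (\<zeta> t \<omega>))\<^sup>2))"
    unfolding B_def using gi gz(1) by simp
  then have BE: "expectation B = (\<alpha> t)\<^sup>2 * (2 * L) * ((8 * \<sigma>\<^sup>2 + 2 * q\<^sup>2 * second_moment) * expectation (gap t))"
    unfolding gz(2) by (simp add: algebra_simps)
  have le: "AE \<omega> in M. (incr t \<omega>)\<^sup>2 \<le> B \<omega>"
    using AE_noise[OF t]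
  proof (rule AE_mp, intro AE_I2 impI)
    fix \<omega> assume N: "norm (noise t \<omega>) \<le> \<sigma>"
    define v where "v = grad t \<omega>"
    define w where "w = weight \<omega>"
    define z where "z = \<zeta> t \<omega>"
    have w: "0 < w" "w \<le> 1" using weight_bounds by (auto simp: w_def)
    have "\<bar>v \<bullet> noise t \<omega>\<bar> \<le> norm v * \<sigma>"
      using Cauchy_Schwarz_ineq2[of v "noise t \<omega>"] N by (meson mult_left_mono norm_ge_zero order_trans)
    then have "slope t \<omega> * \<bar>v \<bullet> noise t \<omega>\<bar> \<le> 2 * (norm v * \<sigma>)"
      using slope_bounds[of t \<omega>] by (intro mult_mono) auto
    moreover have "q * \<bar>v \<bullet> z\<bar> \<le> q * (norm v * norm z)"
      using q_pos Cauchy_Schwarz_ineq2[of v z] by (intro mult_left_mono) auto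
    moreover have "\<bar>slope t \<omega> * (v \<bullet> noise t \<omega>) + q * (v \<bullet> z)\<bar> \<le> slope t \<omega> * \<bar>v \<bullet> noise t \<omega>\<bar> + q * \<bar>v \<bullet> z\<bar>"
      using q_pos slope_bounds(1)[of t \<omega>] abs_triangle_ineq[of "slope t \<omega> * (v \<bullet> noise t \<omega>)" "q * (v \<bullet> z)"]
      by (simp add: abs_mult)
    ultimately have "\<bar>slope t \<omega> * (v \<bullet> noise t \<omega>) + q * (v \<bullet> z)\<bar> \<le> norm v * (2 * \<sigma> + q * norm z)"
      by (simp add: algebra_simps)
    then have "\<bar>slope t \<omega> * (v \<bullet> noise t \<omega>) + q * (v \<bullet> z)\<bar>\<^sup>2 \<le> (norm v * (2 * \<sigma> + q * norm z))\<^sup>2"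
      by (intro power_mono) auto
    \<comment> \<open>The square of a sum is at most twice the sum of squares; 8 comes from the
      bound 2 on \<open>slope\<close>.\<close>
    also have "\<dots> \<le> (norm v)\<^sup>2 * (8 * \<sigma>\<^sup>2 + 2 * q\<^sup>2 * (norm z)\<^sup>2)"
      using sum_squares_bound[of "2 * \<sigma>" "q * norm z"]
      unfolding power_mult_distrib by (intro mult_left_mono) (auto simp: power2_sum power_mult_distrib)
    finally have s: "(slope t \<omega> * (v \<bullet> noise t \<omega>) + q * (v \<bullet> z))\<^sup>2 \<le> (norm v)\<^sup>2 * (8 * \<sigma>\<^sup>2 + 2 * q\<^sup>2 * (norm z)\<^sup>2)"
      by simp
    have "(incr t \<omega>)\<^sup>2 = (\<alpha> t)\<^sup>2 * w\<^sup>2 * (slope t \<omega> * (v \<bullet> noise t \<omega>) + q * (v \<bullet> z))\<^sup>2"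
      by (simp add: incr_def v_def w_def z_def power_mult_distrib)
    also have "\<dots> \<le> (\<alpha> t)\<^sup>2 * w\<^sup>2 * ((norm v)\<^sup>2 * (8 * \<sigma>\<^sup>2 + 2 * q\<^sup>2 * (norm z)\<^sup>2))"
      by (intro mult_left_mono s) auto
    \<comment> \<open>One weight is dropped; the other turns the squared gradient norm into the
      weighted gap.\<close>
    also have "\<dots> \<le> (\<alpha> t)\<^sup>2 * w * ((norm v)\<^sup>2 * (8 * \<sigma>\<^sup>2 + 2 * q\<^sup>2 * (norm z)\<^sup>2))"
      using w by (intro mult_right_mono mult_left_mono) (auto simp: power2_eq_square mult_left_le_one_le)
    also have "\<dots> = (\<alpha> t)\<^sup>2 * ((w * (norm v)\<^sup>2) * (8 * \<sigma>\<^sup>2 + 2 * q\<^sup>2 * (norm z)\<^sup>2))"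
      by (simp add: mult_ac)
    also have "\<dots> \<le> (\<alpha> t)\<^sup>2 * ((2 * L * gap t \<omega>) * (8 * \<sigma>\<^sup>2 + 2 * q\<^sup>2 * (norm z)\<^sup>2))"
      using weighted_gradient_square_le[of \<omega> t] unfolding w_def v_def
      by (intro mult_left_mono mult_right_mono) auto
    also have "\<dots> = B \<omega>" by (simp add: B_def z_def algebra_simps)
    finally show "(incr t \<omega>)\<^sup>2 \<le> B \<omega>" .
  qed
  show i: "integrable M (\<lambda>\<omega>. (incr t \<omega>)\<^sup>2)"
  proof (rule Bochner_Integration.integrable_bound[OF Bi])
    show "AE \<omega> in M. norm ((incr t \<omega>)\<^sup>2) \<le> norm (B \<omega>)"
      using le by (rule AE_mp) (auto intro!: AE_I2 order_trans[OF _ abs_ge_self])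
  qed simp
  have "expectation (\<lambda>\<omega>. (incr t \<omega>)\<^sup>2) \<le> expectation B"
    by (rule integral_mono_AE[OF i Bi le])
  also have "\<dots> \<le> (\<alpha> t)\<^sup>2 * (2 * L) * ((8 * \<sigma>\<^sup>2 + 2 * q\<^sup>2 * second_moment) * gap_bound)"
    unfolding BE using gap_expectation_le[OF t] L_pos second_moment_nonneg by (intro mult_left_mono) auto
  finally show "expectation (\<lambda>\<omega>. (incr t \<omega>)\<^sup>2) \<le> 2 * L * (8 * \<sigma>\<^sup>2 + 2 * q\<^sup>2 * second_moment) * gap_bound * (\<alpha> t)\<^sup>2"
    by (simp only: mult_ac)
qed

section \<open>Almost sure convergence\<close>

lemma AE_incr_summable: "AE \<omega> in M. summable (\<lambda>n. incr (Suc n) \<omega>)"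
proof (rule martingale_difference_series_converges[where F="\<lambda>n. Ft (Suc n)"])
  show "AE \<omega> in M. real_cond_exp M (Ft (Suc n)) (incr (Suc n)) \<omega> = 0" for n
    by (intro incr_centered gap_integrable) auto
  show "summable (\<lambda>n. expectation (\<lambda>\<omega>. (incr (Suc n) \<omega>)\<^sup>2))"
  proof (rule summable_comparison_test')
    show "summable (\<lambda>n. 2 * L * (8 * \<sigma>\<^sup>2 + 2 * q\<^sup>2 * second_moment) * gap_bound * (\<alpha> (Suc n))\<^sup>2)"
      by (intro summable_mult alpha_summable)
    show "norm (expectation (\<lambda>\<omega>. (incr (Suc n) \<omega>)\<^sup>2))
        \<le> 2 * L * (8 * \<sigma>\<^sup>2 + 2 * q\<^sup>2 * second_moment) * gap_bound * (\<alpha> (Suc n))\<^sup>2" for n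
      using incr_square(2)[of "Suc n"] by simp
  qed
qed (auto intro: Ft_sub incr_adapted incr_square(1)
      intro: Ft_mono[unfolded subalgebra_def, THEN conjunct2, THEN subsetD])

lemma AE_rem_summable: "AE \<omega> in M. summable (\<lambda>n. rem (Suc n) \<omega>)"
proof (rule AE_summable_of_summable_expectation)
  show "integrable M (rem (Suc n))" for n by (rule rem_moments) simp
  show "0 \<le> rem (Suc n) \<omega>" for n \<omega> using L_pos by (simp add: rem_def)
  show "summable (\<lambda>n. expectation (rem (Suc n)))"
    using rem_moments(2) by (simp add: alpha_summable summable_mult)
qed

lemma AE_convergence:
  "AE \<omega> in M. summable (\<lambda>n. \<alpha> (Suc n) * Psi q (norm (gradf (x (Suc n) \<omega>)))) \<and>
    convergent (\<lambda>n. f (x (Suc n) \<omega>))"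
proof -
  have "AE \<omega> in M. \<forall>n. gap (Suc (Suc n)) \<omega> \<le> gap (Suc n) \<omega>
      - weight \<omega> / 4 * (\<alpha> (Suc n) * Psi q (norm (grad (Suc n) \<omega>))) + (incr (Suc n) \<omega> + rem (Suc n) \<omega>)"
    unfolding AE_all_countable by (intro allI gap_step) simp
  then show ?thesis
    using AE_incr_summable AE_rem_summable
  proof eventually_elim
    case (elim \<omega>)
    have w: "0 < weight \<omega>" by (rule weight_bounds)
    have P: "0 \<le> weight \<omega> / 4 * (\<alpha> (Suc n) * Psi q (norm (grad (Suc n) \<omega>)))" for n
      using w alpha_pos[of "Suc n"] q_pos by (intro mult_nonneg_nonneg Psi_nonneg) auto
    have "summable (\<lambda>n. incr (Suc n) \<omega> + rem (Suc n) \<omega>)"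
      using elim by (intro summable_add)
    note conv = almost_decreasing_convergent[OF gap_nonneg P spec[OF elim(1)] this]
    \<comment> \<open>On a fixed path the weight is a positive constant, so dividing by it preserves
      convergence.\<close>
    have "summable (\<lambda>n. \<alpha> (Suc n) * Psi q (norm (grad (Suc n) \<omega>)))"
      using summable_mult[OF conv(1), of "4 / weight \<omega>"] w by simp
    moreover have "convergent (\<lambda>n. inverse (weight \<omega>) * gap (Suc n) \<omega> + fstar)"
      using conv(2) by (intro convergent_add convergent_mult convergent_const)
    then have "convergent (\<lambda>n. f (x (Suc n) \<omega>))"
      using w by (simp add: gap_def field_simps)
    ultimately show ?case by (simp add: grad_def)
  qed
qed

end

theorem theorem1:
  fixes f :: "'a::euclidean_space \<Rightarrow> real"
    and gradf :: "'a \<Rightarrow> 'a"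
    and G :: "'a \<Rightarrow> 's \<Rightarrow> 'a"
    and M :: "'w measure" and S :: "'s measure"
    and \<xi> :: "nat \<Rightarrow> 'w \<Rightarrow> 's"
    and \<zeta> x :: "nat \<Rightarrow> 'w \<Rightarrow> 'a"
    and \<alpha> :: "nat \<Rightarrow> real"
    and L q \<theta> fstar \<sigma>\<^sub>g \<sigma>\<^sub>C\<^sub>N :: real
  assumes prob: "prob_space M"
    and fstar_min: "(\<exists>v. f v = fstar) \<and> (\<forall>v. fstar \<le> f v)"
    and gradient: "\<forall>v. GDERIV f v :> gradf v"
    and lipschitz: "L-lipschitz_on UNIV gradf"
    and G_meas: "(\<lambda>(v, s). G v s) \<in> borel_measurable (borel \<Otimes>\<^sub>M S)"
    and x1_meas: "x 1 \<in> borel_measurable M"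
    and xi_meas: "\<forall>t\<ge>1. \<xi> t \<in> measurable M S"
    and zeta_meas: "\<forall>t\<ge>1. \<zeta> t \<in> borel_measurable M"
    and sigma_CN: "0 \<le> \<sigma>\<^sub>C\<^sub>N"
    and zeta_gaussian: "\<forall>t\<ge>1. distr M borel (\<zeta> t) = isotropic_gaussian \<sigma>\<^sub>C\<^sub>N"
    and zeta_indep: "\<forall>t\<ge>1. prob_space.indep_set M
          (sets (vimage_algebra (space M) (\<zeta> t) borel))
          (sets (join_rv (sgd_filtration M S (x 1) \<xi> \<zeta> t) S (\<xi> t)))"
    and unbiased: "\<forall>t\<ge>1. AE \<omega> in M.
          vec_cond_exp M (sgd_filtration M S (x 1) \<xi> \<zeta> t)
            (\<lambda>\<omega>'. G (x t \<omega>') (\<xi> t \<omega>')) \<omega> = gradf (x t \<omega>)"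
    and sigma_g: "0 \<le> \<sigma>\<^sub>g"
    and noise_bounded: "\<forall>t\<ge>1. \<forall>v. AE \<omega> in M. norm (G v (\<xi> t \<omega>) - gradf v) \<le> \<sigma>\<^sub>g"
    and noise_bounded_iterates: "\<forall>t\<ge>1. AE \<omega> in M.
          norm (G (x t \<omega>) (\<xi> t \<omega>) - gradf (x t \<omega>)) \<le> \<sigma>\<^sub>g"
    and q: "\<sigma>\<^sub>g < q" "0 < q"
    and alpha_pos: "\<forall>t\<ge>1. 0 < \<alpha> t"
    and alpha_noninc: "\<forall>t\<ge>1. \<alpha> (Suc t) \<le> \<alpha> t"
    and theta: "0 < \<theta>" "\<theta> < 1 / 2"
    and alpha_Theta: "\<alpha> \<in> \<Theta>(\<lambda>t. real t powr (- (1 - \<theta>)))"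
    and iterates: "\<forall>t\<ge>1. \<forall>\<omega>\<in>space M.
          x (Suc t) \<omega> = x t \<omega> - \<alpha> t *\<^sub>R (clip q (G (x t \<omega>) (\<xi> t \<omega>)) + q *\<^sub>R \<zeta> t \<omega>)"
  shows "(AE \<omega> in M. summable (\<lambda>n. \<alpha> (Suc n) * Psi q (norm (gradf (x (Suc n) \<omega>))))) \<and>
    (\<exists>Y\<in>borel_measurable M. AE \<omega> in M. (\<lambda>t. f (x t \<omega>)) \<longlonglongrightarrow> (Y \<omega> :: real)) \<and>
    (AE \<omega> in M. (\<lambda>t. MIN i\<in>{1..t}. Psi q (norm (gradf (x i \<omega>))))
       \<in> o(\<lambda>t. inverse (\<Sum>i=1..<t. \<alpha> i))) \<and>
    o(\<lambda>t. inverse (\<Sum>i=1..<t. \<alpha> i)) = o(\<lambda>t. real t powr (- \<theta>)) \<and>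
    (AE \<omega> in M. (\<lambda>t. MIN i\<in>{1..t}. Psi q (norm (gradf (x i \<omega>))))
       \<in> o(\<lambda>t. real t powr (- \<theta>))) \<and>
    (AE \<omega> in M. (\<lambda>t. MIN i\<in>{1..t}. norm (gradf (x i \<omega>)))
       \<in> o(\<lambda>t. real t powr (- \<theta> / 2))) \<and>
    (\<forall>\<mu>>0. (\<forall>v w. f w \<ge> f v + gradf v \<bullet> (w - v) + \<mu> / 2 * (norm (w - v))\<^sup>2) \<longrightarrow>
       (AE \<omega> in M. (\<lambda>t. MIN i\<in>{1..t}. f (x i \<omega>) - fstar)
          \<in> o(\<lambda>t. real t powr (- \<theta>))))"
proof -
  \<comment> \<open>\<open>L = 0\<close> is permitted, so the argument runs with the larger,
    positive constant \<open>L + 1\<close>.\<close>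
  have L: "0 < L + 1" using lipschitz_on_nonneg[OF lipschitz] by simp
  have alpha_pos': "0 < \<alpha> t" if "1 \<le> t" for t using alpha_pos that by blast
  note step = step_sum_asymptotics[OF alpha_pos' theta alpha_Theta]
  interpret clipped_noisy_sgd M f gradf G S \<xi> \<zeta> x \<alpha> "L + 1" q fstar \<sigma>\<^sub>g \<sigma>\<^sub>C\<^sub>N
  proof (intro clipped_noisy_sgd.intro clipped_noisy_sgd_axioms.intro prob L)
    show "(L + 1)-lipschitz_on UNIV gradf" by (rule lipschitz_on_le[OF lipschitz]) simp
  qed (use assms step(1) in blast)+
  have conv: "AE \<omega> in M. summable (\<lambda>n. \<alpha> (Suc n) * Psi q (norm (gradf (x (Suc n) \<omega>))))"
    using AE_convergence by (rule AE_mp) simp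
  have lim: "\<exists>Y\<in>borel_measurable M. AE \<omega> in M. (\<lambda>t. f (x t \<omega>)) \<longlonglongrightarrow> (Y \<omega> :: real)"
  proof
    have [measurable]: "x (Suc n) \<in> borel_measurable M" for n by (rule x_meas_M) simp
    \<comment> \<open>\<open>lim\<close> is total and gives a measurable function; on paths without
      a limit its value is arbitrary, but these form a null set.\<close>
    show "(\<lambda>\<omega>. lim (\<lambda>n. f (x (Suc n) \<omega>))) \<in> borel_measurable M" by measurable
    show "AE \<omega> in M. (\<lambda>t. f (x t \<omega>)) \<longlonglongrightarrow> lim (\<lambda>n. f (x (Suc n) \<omega>))"
      using AE_convergence
    proof eventually_elim
      case (elim \<omega>)
      then have "(\<lambda>n. f (x (Suc n) \<omega>)) \<longlonglongrightarrow> lim (\<lambda>n. f (x (Suc n) \<omega>))"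
        by (simp add: convergent_LIMSEQ_iff)
      then show ?case by (rule LIMSEQ_imp_Suc)
    qed
  qed
  have rate: "(\<lambda>t. MIN i\<in>{1..t}. Psi q (norm (gradf (x i \<omega>)))) \<in> o(\<lambda>t. inverse (\<Sum>i=1..<t. \<alpha> i))"
    if "summable (\<lambda>n. \<alpha> (Suc n) * Psi q (norm (gradf (x (Suc n) \<omega>))))" for \<omega>
    using q by (intro running_min_smallo alpha_pos' Psi_nonneg that step(2)) auto
  have "(\<lambda>t. inverse (\<Sum>i=1..<t. \<alpha> i)) \<in> \<Theta>(\<lambda>t. real t powr (- \<theta>))"
    using step(3) by (simp add: powr_minus)
  then have same: "o(\<lambda>t. inverse (\<Sum>i=1..<t. \<alpha> i)) = o(\<lambda>t. real t powr (- \<theta>))"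
    by (rule landau_o.small.cong_bigtheta)
  \<comment> \<open>Used twice: with the squared gradient norm and \<open>K = 1\<close>, and with
    the gap and \<open>K = 1 / (2 * \<mu>)\<close>.\<close>
  have quad: "AE \<omega> in M. (\<lambda>t. MIN i\<in>{1..t}. h (x i \<omega>)) \<in> o(\<lambda>t. real t powr (- \<theta>))"
    if "\<And>v. 0 \<le> h v" "\<And>v. h v \<le> K * (norm (gradf v))\<^sup>2" "0 \<le> K" for h :: "'a \<Rightarrow> real" and K
    using conv
  proof eventually_elim
    case (elim \<omega>)
    show ?case
      by (rule running_min_quadratic_smallo[OF q(2) theta(1) norm_ge_zero that(1) that(2) that(3)
            rate[OF elim, unfolded same]])
  qed
  have "AE \<omega> in M. (\<lambda>t. MIN i\<in>{1..t}. norm (gradf (x i \<omega>))) \<in> o(\<lambda>t. real t powr (- \<theta> / 2))"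
  proof (rule AE_mp[OF quad[of "\<lambda>v. (norm (gradf v))\<^sup>2" 1]])
    show "AE \<omega> in M. (\<lambda>t. MIN i\<in>{1..t}. (norm (gradf (x i \<omega>)))\<^sup>2) \<in> o(\<lambda>t. real t powr (- \<theta>)) \<longrightarrow>
        (\<lambda>t. MIN i\<in>{1..t}. norm (gradf (x i \<omega>))) \<in> o(\<lambda>t. real t powr (- \<theta> / 2))"
      by (intro AE_I2 impI running_min_smallo_sqrt norm_ge_zero)
  qed simp_all
  moreover have "AE \<omega> in M. (\<lambda>t. MIN i\<in>{1..t}. f (x i \<omega>) - fstar) \<in> o(\<lambda>t. real t powr (- \<theta>))"
    if "0 < \<mu>" and sc: "\<forall>v w. f w \<ge> f v + gradf v \<bullet> (w - v) + \<mu> / 2 * (norm (w - v))\<^sup>2" for \<mu>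
  proof (rule quad)
    \<comment> \<open>Strong convexity is applied at an actual minimizer, so attainment of
      \<open>fstar\<close> matters here.\<close>
    obtain w where "f w = fstar" using fstar_min by blast
    then show "f v - fstar \<le> 1 / (2 * \<mu>) * (norm (gradf v))\<^sup>2" for v
      using gap_le_norm_gradient_squared[of \<mu> f v gradf w, OF that(1) sc[rule_format, of v w]] by simp
  qed (use fstar_le that in auto)
  moreover have "AE \<omega> in M. (\<lambda>t. MIN i\<in>{1..t}. Psi q (norm (gradf (x i \<omega>)))) \<in> o(\<lambda>t. inverse (\<Sum>i=1..<t. \<alpha> i))"
    using conv by eventually_elim (rule rate)
  ultimately show ?thesis
    using conv lim unfolding same by blast
qed

end
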